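(* Let $\gamma>0$. There exist a strongly convex $C^\infty$ function $f:\mathbb R\to\mathbb R$ with globally Lipschitz gradient and globally Lipschitz Hessian, a number $r>0$ with friction potential $\phi(v)=r|v|$, and initial data $x_0,v_0\in\mathbb R$, with the following properties. Let $(x_\beta^I,v_\beta^I)$ and $(x_\beta^E,v_\beta^E)$ be the global strong solutions with $x(0)=x_0$, $\dot x(0)=v_0$ of respectively $$\ddot x+\gamma\dot x+\partial\phi(\dot x)+f'(x+\beta\dot x)\ni0\quad\text{and}\quad\ddot x+\gamma\dot x+\partial\phi(\dot x)+\beta f''(x)\dot x+f'(x)\ni0,$$ let $T_\beta^I,T_\beta^E$ be their permanent stopping times, and let $(x^0,v^0)$ be the common solution for $\beta=0$. Then $(x^0,v^0)$ has a finite permanent stopping time $T^0>0$ and there is $\delta>0$ with $-f'(x^0(T^0))+[-\delta,\delta]\subseteq\partial\phi(0)=[-r,r]$; moreover $$\lim_{\beta\downarrow0}\frac{v_\beta^I(t_* )-v_\beta^E(t_* )}{\beta^2}=c_*>0$$ for some constant $c_*$ at some fixed pre-stopping time $t_*\in(0,T^0)$, and $$\lim_{\beta\downarrow0}\frac{T_\beta^I-T_\beta^E}{\beta^2}=c_{\rm stop}>0$$ for some constant $c_{\rm stop}$.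
   Context: $\partial\phi$ is the convex subdifferential. For a force $F(x,v)$ (here $f'(x+\beta v)$ or $f'(x)+\beta f''(x)v$), a strong solution on $[0,T]$ is a pair $(x,v)$ with $x,v\in W^{1,2}(0,T)$, $v=\dot x$ a.e., the given initial values, and some $\xi\in L^2(0,T)$ with $\xi(t)\in\partial\phi(v(t))$ and $\dot v+\gamma v+\xi+F(x,v)=0$ a.e.; a global strong solution is one whose restriction to every $[0,T]$ is strong (such solutions exist and are unique for such $f$ and $\phi$ and every $\beta\ge0$). The permanent stopping time of a trajectory is $\inf\{T\ge0: v(t)=0\text{ for every }t\ge T\}$, with $\inf\varnothing=+\infty$; for small $\beta$ the times $T_\beta^I,T_\beta^E$ are finite. *)

theory Defs
  imports "HOL-Analysis.Analysis"
begin

definition smooth :: "(real \<Rightarrow> real) \<Rightarrow> bool" where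
  "smooth f \<longleftrightarrow> (\<forall>n. (deriv ^^ n) f differentiable_on UNIV)"

definition strongly_convex :: "(real \<Rightarrow> real) \<Rightarrow> bool" where
  "strongly_convex f \<longleftrightarrow> (\<exists>\<mu>>0. \<forall>x y. \<forall>t\<in>{0..1}.
     f (t * x + (1 - t) * y) \<le> t * f x + (1 - t) * f y - \<mu> / 2 * t * (1 - t) * (x - y)\<^sup>2)"

definition globally_lipschitz :: "(real \<Rightarrow> real) \<Rightarrow> bool" where
  "globally_lipschitz g \<longleftrightarrow> (\<exists>L. L-lipschitz_on UNIV g)"

definition subdifferential :: "(real \<Rightarrow> real) \<Rightarrow> real \<Rightarrow> real set" where
  "subdifferential \<phi> v = {\<xi>. \<forall>w. \<phi> v + \<xi> * (w - v) \<le> \<phi> w}"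

definition square_integrable_on :: "real \<Rightarrow> real \<Rightarrow> (real \<Rightarrow> real) \<Rightarrow> bool" where
  "square_integrable_on a b g \<longleftrightarrow>
     g \<in> borel_measurable (lebesgue_on {a<..<b}) \<and>
     integrable (lebesgue_on {a<..<b}) (\<lambda>t. (g t)\<^sup>2)"

text \<open>Sobolev spaces on an interval are set up with test functions in \<open>C\<^sub>c\<^sup>1\<close>, as in Brezis,
  \<^emph>\<open>Functional Analysis, Sobolev Spaces and Partial Differential Equations\<close>, Chapter 8; by
  mollification this is the same as testing with \<open>C\<^sub>c\<close> functions of class \<open>C\<close>-infinity.\<close>

definition test_function :: "real \<Rightarrow> real \<Rightarrow> (real \<Rightarrow> real) \<Rightarrow> bool" where
  "test_function a b \<psi> \<longleftrightarrow>
     \<psi> differentiable_on UNIV \<and> continuous_on UNIV (deriv \<psi>) \<and>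
     closure {t. \<psi> t \<noteq> 0} \<subseteq> {a<..<b}"

text \<open>The definition is meant for square integrable \<open>u\<close> and \<open>g\<close>, for which both integrals exist.\<close>

definition weak_derivative :: "real \<Rightarrow> real \<Rightarrow> (real \<Rightarrow> real) \<Rightarrow> (real \<Rightarrow> real) \<Rightarrow> bool" where
  "weak_derivative a b u g \<longleftrightarrow> (\<forall>\<psi>. test_function a b \<psi> \<longrightarrow>
     (LINT t|lebesgue_on {a<..<b}. u t * deriv \<psi> t) =
     - (LINT t|lebesgue_on {a<..<b}. g t * \<psi> t))"

definition W12_deriv :: "real \<Rightarrow> real \<Rightarrow> (real \<Rightarrow> real) \<Rightarrow> (real \<Rightarrow> real) \<Rightarrow> bool" where
  "W12_deriv a b u g \<longleftrightarrow>
     square_integrable_on a b u \<and> square_integrable_on a b g \<and> weak_derivative a b u g"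

text \<open>The pointwise values \<open>x t\<close>, \<open>v t\<close> refer to the continuous representatives of the
  \<open>W\<^sup>1\<^sup>,\<^sup>2\<close> classes; this is what the continuity requirement fixes.\<close>

definition strong_solution ::
  "real \<Rightarrow> (real \<Rightarrow> real) \<Rightarrow> (real \<Rightarrow> real \<Rightarrow> real) \<Rightarrow> real \<Rightarrow> real \<Rightarrow> real
    \<Rightarrow> (real \<Rightarrow> real) \<Rightarrow> (real \<Rightarrow> real) \<Rightarrow> bool" where
  "strong_solution \<gamma> \<phi> F x0 v0 T x v \<longleftrightarrow>
     continuous_on {0..T} x \<and> continuous_on {0..T} v \<and> x 0 = x0 \<and> v 0 = v0 \<and>
     (\<exists>dx dv \<xi>. W12_deriv 0 T x dx \<and> W12_deriv 0 T v dv \<and> square_integrable_on 0 T \<xi> \<and>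
        (AE t in lebesgue_on {0<..<T}.
           v t = dx t \<and> \<xi> t \<in> subdifferential \<phi> (v t) \<and>
           dv t + \<gamma> * v t + \<xi> t + F (x t) (v t) = 0))"

definition global_strong_solution ::
  "real \<Rightarrow> (real \<Rightarrow> real) \<Rightarrow> (real \<Rightarrow> real \<Rightarrow> real) \<Rightarrow> real \<Rightarrow> real
    \<Rightarrow> (real \<Rightarrow> real) \<Rightarrow> (real \<Rightarrow> real) \<Rightarrow> bool" where
  "global_strong_solution \<gamma> \<phi> F x0 v0 x v \<longleftrightarrow>
     (\<forall>T>0. strong_solution \<gamma> \<phi> F x0 v0 T x v)"

text \<open>\<open>(x, v)\<close> is \<^emph>\<open>the\<close> global strong solution. Trajectories live on \<open>t \<ge> 0\<close>; their values at
  negative times are irrelevant.\<close>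

definition the_global_strong_solution ::
  "real \<Rightarrow> (real \<Rightarrow> real) \<Rightarrow> (real \<Rightarrow> real \<Rightarrow> real) \<Rightarrow> real \<Rightarrow> real
    \<Rightarrow> (real \<Rightarrow> real) \<Rightarrow> (real \<Rightarrow> real) \<Rightarrow> bool" where
  "the_global_strong_solution \<gamma> \<phi> F x0 v0 x v \<longleftrightarrow>
     global_strong_solution \<gamma> \<phi> F x0 v0 x v \<and>
     (\<forall>y w. global_strong_solution \<gamma> \<phi> F x0 v0 y w \<longrightarrow> (\<forall>t\<ge>0. y t = x t \<and> w t = v t))"

definition implicit_force :: "(real \<Rightarrow> real) \<Rightarrow> real \<Rightarrow> real \<Rightarrow> real \<Rightarrow> real" where
  "implicit_force f \<beta> x v = deriv f (x + \<beta> * v)"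

definition explicit_force :: "(real \<Rightarrow> real) \<Rightarrow> real \<Rightarrow> real \<Rightarrow> real \<Rightarrow> real" where
  "explicit_force f \<beta> x v = deriv f x + \<beta> * deriv (deriv f) x * v"

definition stopping_time :: "(real \<Rightarrow> real) \<Rightarrow> ereal" where
  "stopping_time v = Inf {ereal T |T. T \<ge> 0 \<and> (\<forall>t\<ge>T. v t = 0)}"

end

(* While the particle moves its speed decreases strictly, so the trajectory can be parametrised by
   the speed w in [0, 1]: the position X(w) solves a scalar integral equation that is a contraction
   uniformly in beta, and the stopping time is the integral over [0, 1] of the slowness
   1 / (gamma w + r + F(X(w), w)). For f(x) = x^2 + x + sin x with x0 = 0, v0 = 1, r = 4 every
   trajectory stops where |f'| <= r and then sticks. The two forces differ by
   beta^2 w^2 f'''(x) / 2 + O(beta^3); dividing by beta^2, the difference of the slownesses converges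
   uniformly to the solution of the linearised equation. As f''' = - cos x < 0 on the trajectory and
   r is large, the source term dominates the feedback through the positions, so the limit has
   positive integral. Uniqueness of strong solutions follows from du Bois-Reymond and Gronwall. *)

theory Submission
  imports Defs
begin

section \<open>The potential\<close>

text \<open>Each arc deviates from the one for \<beta> = 0 to order \<beta>, whereas the gap sought
  is of order \<beta>^2. Hence the two arcs are compared with each other, and the arc for \<beta> =
  0 only supplies the limits of the coefficients. At equal speed the friction force is the same
  constant on both, so nothing nonsmooth enters. Origin of the constants: x^2 gives f'' = 2 - sin x
  \<ge> 1, the linear term gives f' \<ge> 0 for x \<ge> 0, and the sine makes f''' negative, so that
  the implicit force brakes less. With r = 4 the deceleration is at least 4 for every \<gamma> > 0
  and the path has length at most 1/4; there f' \<le> 3, which leaves a sticking margin of 1, and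
  cos x \<ge> 1/2. The Lipschitz constant 3 of f' becomes 3/16 for the slowness. This number serves
  twice: it is below the 1/2 needed for contraction, and it limits the feedback to 3/8 of the total
  weight K of the source, which itself contributes at least K/2.\<close>

definition potential :: "real \<Rightarrow> real" where
  "potential x = x\<^sup>2 + x + sin x"

abbreviation slope :: "real \<Rightarrow> real" where
  "slope x \<equiv> 2 * x + 1 + cos x"

lemma has_real_derivative_potential: "(potential has_real_derivative slope x) (at x)"
  unfolding potential_def[abs_def] by (auto intro!: derivative_eq_intros)

lemma deriv_potential: "deriv potential = slope"
  using DERIV_imp_deriv[OF has_real_derivative_potential] by blast

lemma has_real_derivative_slope: "(slope has_real_derivative 2 - sin x) (at x)"
  by (auto intro!: derivative_eq_intros)

lemma deriv_slope: "deriv slope = (\<lambda>x. 2 - sin x)"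
  using DERIV_imp_deriv[OF has_real_derivative_slope] by blast

text \<open>From the second derivative on, everything stays in the span of 1, sin and cos, which is
  closed under differentiation.\<close>

lemma higher_deriv_potential:
  "\<exists>a b c. (deriv ^^ (n + 2)) potential = (\<lambda>x. a + b * sin x + c * cos x)"
proof (induction n)
  case 0
  have "(deriv ^^ (0 + 2)) potential = (\<lambda>x. 2 + (-1) * sin x + 0 * cos x)"
    by (simp add: numeral_2_eq_2 deriv_potential deriv_slope)
  then show ?case by blast
next
  case (Suc n)
  then obtain a b c where "(deriv ^^ (n + 2)) potential = (\<lambda>x. a + b * sin x + c * cos x)"
    by blast
  moreover have "deriv (\<lambda>x. a + b * sin x + c * cos x) = (\<lambda>x. 0 + (- c) * sin x + b * cos x)"
    by (rule ext, rule DERIV_imp_deriv) (auto intro!: derivative_eq_intros)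
  ultimately have "(deriv ^^ (Suc n + 2)) potential = (\<lambda>x. 0 + (- c) * sin x + b * cos x)"
    by simp
  then show ?case by blast
qed

lemma smooth_potential: "smooth potential"
  unfolding smooth_def
proof
  fix n :: nat
  consider "n = 0" | "n = 1" | m where "n = m + 2"
    by (metis One_nat_def add_2_eq_Suc' not0_implies_Suc)
  then show "(deriv ^^ n) potential differentiable_on UNIV"
  proof cases
    case 1
    then show ?thesis
      using has_real_derivative_potential
      by (auto simp: differentiable_on_def real_differentiable_def intro: differentiable_at_withinI)
  next
    case 2
    then show ?thesis
      using has_real_derivative_slope
      by (auto simp: differentiable_on_def deriv_potential real_differentiable_def
          intro: differentiable_at_withinI)
  next
    case 3
    then obtain a b c where *: "(deriv ^^ n) potential = (\<lambda>x. a + b * sin x + c * cos x)"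
      using higher_deriv_potential by blast
    have "((\<lambda>x. a + b * sin x + c * cos x) has_real_derivative b * cos x - c * sin x) (at x)" for x
      by (auto intro!: derivative_eq_intros)
    then show ?thesis
      unfolding * differentiable_on_def real_differentiable_def by auto
  qed
qed

lemma strongly_convex_potential: "strongly_convex potential"
  unfolding strongly_convex_def
proof (intro exI[of _ 1] conjI allI ballI)
  fix x y t :: real assume t: "t \<in> {0..1}"
  \<comment> \<open>\<open>g\<close> is \<open>potential\<close> minus x^2/2. Convexity of this
    difference is strong convexity of \<open>potential\<close> with modulus 1, by the quadratic
    identity for x^2/2.\<close>
  define g where "g = (\<lambda>x::real. x\<^sup>2 / 2 + x + sin x)"
  have "convex_on UNIV g"
  proof (rule f''_ge0_imp_convex[where f' = "\<lambda>x. x + 1 + cos x" and f'' = "\<lambda>x. 1 - sin x"])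
    show "(g has_real_derivative x + 1 + cos x) (at x)" for x
      unfolding g_def by (auto intro!: derivative_eq_intros)
    show "((\<lambda>x. x + 1 + cos x) has_real_derivative 1 - sin x) (at x)" for x :: real
      by (auto intro!: derivative_eq_intros)
  qed auto
  from convex_onD[OF this, of "1 - t" x y] t
  have "g (t * x + (1 - t) * y) \<le> t * g x + (1 - t) * g y" by simp
  then show "potential (t * x + (1 - t) * y)
      \<le> t * potential x + (1 - t) * potential y - 1 / 2 * t * (1 - t) * (x - y)\<^sup>2"
    unfolding g_def potential_def by (simp add: power2_eq_square field_simps)
qed simp

lemma sin_diff_le: "\<bar>sin x - sin y\<bar> \<le> \<bar>x - y\<bar>" for x y :: real
proof -
  have "1-lipschitz_on UNIV (sin :: real \<Rightarrow> real)"
    by (rule bounded_derivative_imp_lipschitz[where f' = "\<lambda>x h. h * cos x"])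
       (auto intro!: derivative_eq_intros onorm_le simp: mult_left_le abs_mult onorm_bound)
  then show ?thesis by (auto simp: lipschitz_on_def dist_real_def)
qed

lemma cos_diff_le: "\<bar>cos x - cos y\<bar> \<le> \<bar>x - y\<bar>" for x y :: real
  using sin_diff_le[of "x + pi / 2" "y + pi / 2"] by (simp add: sin_add)

lemma slope_diff_le: "\<bar>slope x - slope y\<bar> \<le> 3 * \<bar>x - y\<bar>"
  using cos_diff_le[of x y] by (simp add: abs_if split: if_splits)

lemma lipschitz_slope: "globally_lipschitz slope"
  unfolding globally_lipschitz_def
  by (rule exI[of _ 3], rule lipschitz_onI) (use slope_diff_le in \<open>auto simp: dist_real_def simp del: minus_diff_eq\<close>)

lemma lipschitz_deriv_slope: "globally_lipschitz (\<lambda>x. 2 - sin x)"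
  unfolding globally_lipschitz_def
  by (rule exI[of _ 1], rule lipschitz_onI) (use sin_diff_le in \<open>auto simp: dist_real_def abs_minus_commute\<close>)

section \<open>Weak derivatives\<close>

text \<open>The squared positive part is just smooth enough: test functions need one continuous
  derivative, and piecewise quadratics keep all formulas explicit.\<close>

definition ramp :: "real \<Rightarrow> real" where
  "ramp x = (max 0 x)\<^sup>2"

lemma has_real_derivative_ramp: "(ramp has_real_derivative 2 * max 0 x) (at x)"
proof -
  consider "x < 0" | "x = 0" | "x > 0" by linarith
  then show ?thesis
  proof cases
    case 1
    have "((\<lambda>x. 0) has_real_derivative 2 * max 0 x) (at x)"
      using 1 by simp
    then show ?thesis
      by (rule DERIV_cong_ev[THEN iffD1, rotated -1, OF _ refl _ refl])
         (use 1 in \<open>auto simp: ramp_def max_def intro!: eventually_nhds_in_open[of "{..<0}", THEN eventually_mono]\<close>)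
  next
    case 3
    have "((\<lambda>x. x\<^sup>2) has_real_derivative 2 * max 0 x) (at x)"
      using 3 by (auto intro!: derivative_eq_intros)
    then show ?thesis
      by (rule DERIV_cong_ev[THEN iffD1, rotated -1, OF _ refl _ refl])
         (use 3 in \<open>auto simp: ramp_def max_def intro!: eventually_nhds_in_open[of "{0<..}", THEN eventually_mono]\<close>)
  next
    case 2
    have "((\<lambda>h. (ramp (0 + h) - ramp 0) / h) \<longlongrightarrow> 0) (at 0)"
    proof (rule Lim_null_comparison)
      show "\<forall>\<^sub>F h in at 0. norm ((ramp (0 + h) - ramp 0) / h) \<le> \<bar>h\<bar>"
        by (rule always_eventually) (auto simp: ramp_def max_def power2_eq_square)
      show "((\<lambda>h::real. \<bar>h\<bar>) \<longlongrightarrow> 0) (at 0)"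
        using tendsto_rabs[OF tendsto_ident_at[of "0::real" UNIV]] by simp
    qed
    then show ?thesis using 2 by (simp add: DERIV_def)
  qed
qed

text \<open>A \<open>C\<^sup>1\<close> transition from 0 to 1 on the unit interval; its derivative is a hat function.\<close>

definition smoothstep :: "real \<Rightarrow> real" where
  "smoothstep x = 2 * (ramp x - 2 * ramp (x - 1/2) + ramp (x - 1))"

definition hat :: "real \<Rightarrow> real" where
  "hat x = 4 * (max 0 x - 2 * max 0 (x - 1/2) + max 0 (x - 1))"

lemma has_real_derivative_smoothstep: "(smoothstep has_real_derivative hat x) (at x)"
  unfolding smoothstep_def hat_def
  by (auto intro!: derivative_eq_intros DERIV_chain2[OF has_real_derivative_ramp])

lemma smoothstep_eq_0: "x \<le> 0 \<Longrightarrow> smoothstep x = 0"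
  by (simp add: smoothstep_def ramp_def)

lemma smoothstep_eq_1: "x \<ge> 1 \<Longrightarrow> smoothstep x = 1"
  by (simp add: smoothstep_def ramp_def power2_eq_square algebra_simps)

lemma hat_nonneg: "hat x \<ge> 0"
  by (simp add: hat_def max_def)

lemma hat_eq_0: "x \<notin> {0<..<1} \<Longrightarrow> hat x = 0"
  by (auto simp: hat_def max_def)

lemma continuous_on_hat: "continuous_on S hat"
  unfolding hat_def by (intro continuous_intros)

lemma smoothstep_bounds: "0 \<le> smoothstep x" "smoothstep x \<le> 1"
proof -
  have mono: "smoothstep a \<le> smoothstep b" if "a \<le> b" for a b
    using that has_real_derivative_smoothstep hat_nonneg by (meson DERIV_nonneg_imp_nondecreasing)
  show "0 \<le> smoothstep x"
    using mono[of "min x 0" x] smoothstep_eq_0[of "min x 0"] by simp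
  show "smoothstep x \<le> 1"
    using mono[of x "max x 1"] smoothstep_eq_1[of "max x 1"] by simp
qed

text \<open>The scaled hats are a one-sided approximate identity: they have unit mass and live on
  the interval from \<open>a\<close> to \<open>a + 1/n\<close>.\<close>

lemma integral_hat_tendsto:
  fixes u :: "real \<Rightarrow> real"
  assumes u: "continuous_on {0..T} u" and a: "0 < a" "a < T"
  shows "(\<lambda>n. integral {0..T} (\<lambda>t. u t * (real n * hat (real n * (t - a))))) \<longlonglongrightarrow> u a"
proof (rule LIMSEQ_I)
  fix e :: real assume "e > 0"
  then obtain d where d: "d > 0" "\<And>t. t \<in> {0..T} \<Longrightarrow> dist t a < d \<Longrightarrow> dist (u t) (u a) < e / 2"
    using u a unfolding continuous_on_iff by (metis atLeastAtMost_iff half_gt_zero less_eq_real_def)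
  \<comment> \<open>Below \<open>h\<close> the support lies both in the continuity neighbourhood of
    \<open>a\<close> and in \<open>{0..T}\<close>, so that no mass is lost at the right end.\<close>
  define h where "h = min d (T - a)"
  have "h > 0" using d a by (simp add: h_def)
  obtain N where N: "1 / h < real N" using reals_Archimedean2 by blast
  show "\<exists>N. \<forall>n\<ge>N. norm (integral {0..T} (\<lambda>t. u t * (real n * hat (real n * (t - a)))) - u a) < e"
  proof (intro exI allI impI)
    fix n assume "n \<ge> N"
    with N have nh: "1 / h < real n" by linarith
    have "0 < 1 / h" using \<open>h > 0\<close> by simp
    with nh have "real n > 0" by linarith
    with nh \<open>h > 0\<close> have n: "real n > 0" "1 / real n < h"
      by (auto simp: field_simps)
    define k where "k = (\<lambda>t. real n * hat (real n * (t - a)))"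
    have k0: "k t = 0" if "t \<notin> {a<..<a + h}" for t
    proof (cases "t \<le> a")
      case True
      with n have "real n * (t - a) \<le> 0" by (intro mult_nonneg_nonpos) auto
      then show ?thesis by (auto simp: k_def intro!: hat_eq_0)
    next
      case False
      with that have "t - a \<ge> h" by auto
      with n have "t - a \<ge> 1 / real n" by linarith
      with n have "real n * (t - a) \<ge> 1" by (simp add: field_simps)
      then show ?thesis by (auto simp: k_def intro!: hat_eq_0)
    qed
    have k_nonneg: "k t \<ge> 0" for t using hat_nonneg by (simp add: k_def)
    have contk: "continuous_on {0..T} k"
      unfolding k_def by (intro continuous_intros continuous_on_compose2[OF continuous_on_hat[of UNIV]]) auto
    have "(k has_integral (smoothstep (real n * (T - a)) - smoothstep (real n * (0 - a)))) {0..T}"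
    proof (rule fundamental_theorem_of_calculus)
      fix t assume "t \<in> {0..T}"
      have "((\<lambda>t. smoothstep (real n * (t - a))) has_real_derivative k t) (at t)"
        unfolding k_def
        by (rule DERIV_cong[OF DERIV_chain2[OF has_real_derivative_smoothstep]])
           (auto intro!: derivative_eq_intros)
      then show "((\<lambda>t. smoothstep (real n * (t - a))) has_vector_derivative k t) (at t within {0..T})"
        by (simp add: has_real_derivative_iff_has_vector_derivative has_vector_derivative_at_within)
    qed (use a in simp)
    moreover have "smoothstep (real n * (T - a)) = 1"
    proof (rule smoothstep_eq_1)
      have "1 / real n \<le> T - a" using n h_def by linarith
      with n show "1 \<le> real n * (T - a)" by (simp add: field_simps)
    qed
    moreover have "smoothstep (real n * (0 - a)) = 0"
      using a by (intro smoothstep_eq_0) (simp add: mult_le_0_iff)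
    ultimately have kint: "(k has_integral 1) {0..T}" by simp
    have uk: "(\<lambda>t. u t * k t) integrable_on {0..T}"
      by (intro integrable_continuous_interval continuous_intros u contk)
    \<comment> \<open>Since \<open>k\<close> has mass 1, the constant \<open>u a\<close> can be
      moved under the integral.\<close>
    have "integral {0..T} (\<lambda>t. u t * k t) - u a = integral {0..T} (\<lambda>t. u t * k t - u a * k t)"
      using has_integral_diff[OF integrable_integral[OF uk] has_integral_mult_right[OF kint, of "u a"]]
      by (simp add: integral_unique)
    also have "norm \<dots> \<le> integral {0..T} (\<lambda>t. e / 2 * k t)"
    proof (rule integral_norm_bound_integral)
      show "(\<lambda>t. u t * k t - u a * k t) integrable_on {0..T}"
        by (intro integrable_continuous_interval continuous_intros u contk)
      show "(\<lambda>t. e / 2 * k t) integrable_on {0..T}"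
        by (intro integrable_continuous_interval continuous_intros contk)
      fix t assume t: "t \<in> {0..T}"
      show "norm (u t * k t - u a * k t) \<le> e / 2 * k t"
      proof (cases "t \<in> {a<..<a + h}")
        case True
        then have "dist t a < d" by (auto simp: dist_real_def h_def)
        with t d(2)[of t] have "\<bar>u t - u a\<bar> \<le> e / 2" by (simp add: dist_real_def)
        then have "\<bar>u t - u a\<bar> * k t \<le> e / 2 * k t" by (rule mult_right_mono) (rule k_nonneg)
        then show ?thesis using k_nonneg[of t] by (simp add: abs_mult flip: left_diff_distrib)
      qed (simp add: k0)
    qed
    also have "\<dots> = e / 2"
      using integral_unique[OF has_integral_mult_right[OF kint, of "e / 2"]] by simp
    finally show "norm (integral {0..T} (\<lambda>t. u t * (real n * hat (real n * (t - a)))) - u a) < e"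
      using \<open>e > 0\<close> by (simp add: k_def)
  qed
qed

text \<open>A C1 approximation of the indicator of \<open>{a<..b}\<close>: one step rises just after
  \<open>a\<close>, the other is subtracted just after \<open>b\<close>. The condition on
  \<open>n\<close> keeps the support compact inside the open interval.\<close>

lemma test_function_smoothstep:
  assumes "0 < a" "a < b" "b + 1 / real n < T" "n > 0"
  defines "\<psi> \<equiv> \<lambda>t. smoothstep (real n * (t - a)) - smoothstep (real n * (t - b))"
  shows "test_function 0 T \<psi>"
    and "deriv \<psi> = (\<lambda>t. real n * hat (real n * (t - a)) - real n * hat (real n * (t - b)))"
proof -
  have D: "(\<psi> has_real_derivative real n * hat (real n * (t - a)) - real n * hat (real n * (t - b))) (at t)" for t
    unfolding \<psi>_def
    by (auto intro!: derivative_eq_intros DERIV_chain2[OF has_real_derivative_smoothstep])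
  then show deriv: "deriv \<psi> = (\<lambda>t. real n * hat (real n * (t - a)) - real n * hat (real n * (t - b)))"
    using DERIV_imp_deriv by blast
  have "{t. \<psi> t \<noteq> 0} \<subseteq> {a..b + 1 / real n}"
  proof (rule ccontr)
    assume "\<not> {t. \<psi> t \<noteq> 0} \<subseteq> {a..b + 1 / real n}"
    then obtain t where t: "\<psi> t \<noteq> 0" "t < a \<or> t > b + 1 / real n" by force
    show False
    proof (cases "t < a")
      case True
      with assms have "real n * (t - a) \<le> 0" "real n * (t - b) \<le> 0"
        by (auto intro!: mult_nonneg_nonpos)
      with t show False by (simp add: \<psi>_def smoothstep_eq_0)
    next
      case False
      with t assms have "real n * (1 / real n) \<le> real n * (t - a)" "real n * (1 / real n) \<le> real n * (t - b)"
        by (intro mult_left_mono; simp)+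
      with assms have "real n * (t - a) \<ge> 1" "real n * (t - b) \<ge> 1" by simp_all
      with t show False by (simp add: \<psi>_def smoothstep_eq_1)
    qed
  qed
  then have "closure {t. \<psi> t \<noteq> 0} \<subseteq> {a..b + 1 / real n}"
    by (rule closure_minimal) simp
  also have "\<dots> \<subseteq> {0<..<T}" using assms by auto
  finally have "closure {t. \<psi> t \<noteq> 0} \<subseteq> {0<..<T}" .
  moreover have "\<psi> differentiable_on UNIV"
    using D by (auto simp: differentiable_on_def real_differentiable_def)
  moreover have "continuous_on UNIV (deriv \<psi>)"
    unfolding deriv
    by (intro continuous_intros continuous_on_compose2[OF continuous_on_hat[of UNIV]]) auto
  ultimately show "test_function 0 T \<psi>" by (simp add: test_function_def)
qed

section \<open>From weak derivatives to increments of the continuous representative\<close>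

lemma Ioo_sets_lebesgue [simp]: "{a<..<b::real} \<in> sets lebesgue"
  by simp

text \<open>Bridge between the Lebesgue integral on the open interval, in which the Sobolev notions
  are stated, and the gauge integral on the closed interval, in which the calculus is done.\<close>

lemma continuous_integrable_Ioo:
  fixes u :: "real \<Rightarrow> real"
  assumes "continuous_on {a..b} u"
  shows "integrable (lebesgue_on {a<..<b}) u"
    and "(LINT t|lebesgue_on {a<..<b}. u t) = integral {a..b} u"
proof -
  have "set_integrable lebesgue {a..b} u"
    using assms by (rule absolutely_integrable_continuous_real)
  then have "set_integrable lebesgue {a<..<b} u"
    by (rule set_integrable_subset) auto
  then show *: "integrable (lebesgue_on {a<..<b}) u"
    by (simp add: integrable_restrict_space set_integrable_def)
  show "(LINT t|lebesgue_on {a<..<b}. u t) = integral {a..b} u"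
    by (subst lebesgue_integral_eq_integral[OF *]) (simp_all add: integral_open_interval_real)
qed

text \<open>Test with smoothed indicators of \<open>{a<..b}\<close>. On one side their derivatives
  are two approximate identities and produce \<open>u a - u b\<close>; on the other side dominated
  convergence with majorant \<open>|g|\<close> produces the integral of \<open>g\<close>.\<close>

lemma weak_derivative_imp_integral_interior:
  fixes u g :: "real \<Rightarrow> real"
  assumes u: "continuous_on {0..T} u" and g: "integrable (lebesgue_on {0<..<T}) g"
    and weak: "weak_derivative 0 T u g" and ab: "0 < a" "a < b" "b < T"
  shows "(g has_integral u b - u a) {a..b}"
proof -
  let ?M = "lebesgue_on {0<..<T}"
  define \<psi> where "\<psi> = (\<lambda>n t. smoothstep (real n * (t - a)) - smoothstep (real n * (t - b)))"
  obtain N where "1 / (T - b) < real N" using reals_Archimedean2 by blast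
  have N: "b + 1 / real n < T" "n > 0" if "n \<ge> N" for n
  proof -
    have n: "1 / (T - b) < real n" using that \<open>1 / (T - b) < real N\<close> by linarith
    moreover have "0 < 1 / (T - b)" using ab by simp
    ultimately have "real n > 0" by linarith
    then show "n > 0" by simp
    show "b + 1 / real n < T" using n \<open>real n > 0\<close> ab by (simp add: field_simps)
  qed
  have lim_u: "(\<lambda>n. LINT t|?M. u t * deriv (\<psi> n) t) \<longlonglongrightarrow> u a - u b"
  proof (rule Lim_transform_eventually)
    let ?K = "\<lambda>c n t. u t * (real n * hat (real n * (t - c)))"
    show "(\<lambda>n. integral {0..T} (?K a n) - integral {0..T} (?K b n)) \<longlonglongrightarrow> u a - u b"
      using ab by (intro tendsto_diff integral_hat_tendsto u) auto
    have cont: "continuous_on {0..T} (?K c n)" for c n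
      by (intro continuous_intros u continuous_on_compose2[OF continuous_on_hat[of UNIV]]) auto
    show "\<forall>\<^sub>F n in sequentially. integral {0..T} (?K a n) - integral {0..T} (?K b n)
        = (LINT t|?M. u t * deriv (\<psi> n) t)"
      using eventually_ge_at_top[of N]
    proof eventually_elim
      case (elim n)
      have "(LINT t|?M. u t * deriv (\<psi> n) t) = (LINT t|?M. ?K a n t - ?K b n t)"
        unfolding \<psi>_def using ab N[OF elim]
        by (subst test_function_smoothstep) (auto simp: algebra_simps)
      also have "\<dots> = integral {0..T} (\<lambda>t. ?K a n t - ?K b n t)"
        by (intro continuous_integrable_Ioo continuous_on_diff cont)
      also have "\<dots> = integral {0..T} (?K a n) - integral {0..T} (?K b n)"
        by (intro integral_diff integrable_continuous_interval cont)
      finally show ?case by simp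
    qed
  qed
  have "(\<lambda>n. LINT t|?M. g t * \<psi> n t) \<longlonglongrightarrow> (LINT t|?M. g t * indicator {a<..b} t)"
  proof (rule integral_dominated_convergence[where w = "\<lambda>t. \<bar>g t\<bar>"])
    have gm: "g \<in> borel_measurable ?M" using g by auto
    show "integrable ?M (\<lambda>t. \<bar>g t\<bar>)" using g by simp
    show "(\<lambda>t. g t * indicator {a<..b} t) \<in> borel_measurable ?M"
      using ab
      by (intro borel_measurable_times gm) (auto simp: borel_measurable_indicator_iff sets_restrict_space_iff)
    show "(\<lambda>t. g t * \<psi> n t) \<in> borel_measurable ?M" for n
    proof (intro borel_measurable_times gm continuous_imp_measurable_on_sets_lebesgue)
      show "continuous_on {0<..<T} (\<psi> n)"
        unfolding \<psi>_def
        by (intro continuous_intros continuous_on_compose2[OF DERIV_continuous_on[OF has_field_derivative_at_within[OF has_real_derivative_smoothstep], of UNIV]]) auto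
    qed simp
    have "\<bar>\<psi> n t\<bar> \<le> 1" for n t
      using smoothstep_bounds[of "real n * (t - a)"] smoothstep_bounds[of "real n * (t - b)"]
      by (simp add: \<psi>_def abs_le_iff)
    then show "AE t in ?M. norm (g t * \<psi> n t) \<le> \<bar>g t\<bar>" for n
      by (auto simp: abs_mult intro!: always_eventually mult_left_le)
    \<comment> \<open>At \<open>s = 0\<close> the limit is 0, because the step only begins to rise
      there; this is why the limiting indicator is that of the half-open interval.\<close>
    have step: "(\<lambda>n. smoothstep (real n * s)) \<longlonglongrightarrow> (if s > 0 then 1 else 0)" for s
    proof (cases "s > 0")
      case True
      obtain N where N: "1 / s < real N" using reals_Archimedean2 by blast
      show ?thesis
      proof (rule tendsto_eventually, rule eventually_sequentiallyI)
        fix n assume "n \<ge> N"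
        with N have "1 / s < real n" by linarith
        then have "real n * s \<ge> 1" using True by (simp add: field_simps)
        then show "smoothstep (real n * s) = (if s > 0 then 1 else 0)"
          using True by (simp add: smoothstep_eq_1)
      qed
    next
      case False
      then show ?thesis by (simp add: smoothstep_eq_0 mult_nonneg_nonpos)
    qed
    have "(\<lambda>n. \<psi> n t) \<longlonglongrightarrow> indicator {a<..b} t" for t
    proof -
      have "(\<lambda>n. \<psi> n t) \<longlonglongrightarrow> (if t - a > 0 then 1 else 0) - (if t - b > 0 then 1 else 0)"
        unfolding \<psi>_def by (intro tendsto_diff step)
      also have "(if t - a > 0 then 1 else 0) - (if t - b > 0 then 1 else 0) = (indicator {a<..b} t :: real)"
        using ab by (auto simp: indicator_def)
      finally show ?thesis .
    qed
    then show "AE t in ?M. (\<lambda>n. g t * \<psi> n t) \<longlonglongrightarrow> g t * indicator {a<..b} t"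
      by (intro always_eventually allI tendsto_mult tendsto_const)
  qed
  moreover have "\<forall>\<^sub>F n in sequentially. (LINT t|?M. g t * \<psi> n t) = - (LINT t|?M. u t * deriv (\<psi> n) t)"
    using eventually_ge_at_top[of N]
  proof eventually_elim
    case (elim n)
    have "test_function 0 T (\<psi> n)"
      unfolding \<psi>_def using ab N[OF elim] by (intro test_function_smoothstep) auto
    with weak show ?case by (simp add: weak_derivative_def)
  qed
  ultimately have "(\<lambda>n. - (LINT t|?M. u t * deriv (\<psi> n) t)) \<longlonglongrightarrow> (LINT t|?M. g t * indicator {a<..b} t)"
    by (rule Lim_transform_eventually)
  with tendsto_minus[OF lim_u] have eq: "(LINT t|?M. g t * indicator {a<..b} t) = u b - u a"
    using LIMSEQ_unique by fastforce
  have "integrable ?M (\<lambda>t. g t * indicator {a<..b} t)"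
  proof -
    have "{a<..b} \<subseteq> {0<..<T}" using ab by auto
    then show ?thesis
      using integrable_mult_indicator[of "{a<..b}" ?M g] g
      by (simp add: sets_restrict_space_iff mult.commute)
  qed
  then have "((\<lambda>t. g t * indicator {a<..b} t) has_integral u b - u a) {0<..<T}"
    unfolding eq[symmetric] by (rule has_integral_integral_lebesgue_on) simp
  then have "((\<lambda>t. if t \<in> {a<..b} then g t else 0) has_integral u b - u a) {0<..<T}"
    by (rule has_integral_eq[rotated]) auto
  then have "(g has_integral u b - u a) {a<..b}"
    using ab by (subst (asm) has_integral_restrict) auto
  then show ?thesis
  proof (rule has_integral_spike_set_eq[THEN iffD1, rotated -1])
    show "negligible {x \<in> {a<..b} - {a..b}. g x \<noteq> 0}"
      by (rule negligible_subset[of "{}"]) auto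
    show "negligible {x \<in> {a..b} - {a<..b}. g x \<noteq> 0}"
      by (rule negligible_subset[of "{a}"]) auto
  qed
qed

text \<open>The endpoints 0 and \<open>T\<close> are out of reach of test functions. They are
  recovered by continuity: \<open>u\<close> minus the primitive of \<open>g\<close> is continuous on
  the closed interval and constant on its interior.\<close>

lemma weak_derivative_imp_integral:
  fixes u g :: "real \<Rightarrow> real"
  assumes u: "continuous_on {0..T} u" and g: "integrable (lebesgue_on {0<..<T}) g"
    and weak: "weak_derivative 0 T u g" and st: "0 \<le> s" "s \<le> t" "t \<le> T"
  shows "(g has_integral u t - u s) {s..t}"
proof (cases "0 < T")
  case True
  have gint: "g integrable_on {0..T}"
    using integrable_on_lebesgue_on[OF g] by (simp add: integrable_on_open_interval_real)
  define d where "d = (\<lambda>t. u t - integral {0..t} g)"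
  have split: "integral {0..b} g = integral {0..a} g + integral {a..b} g"
    if "0 \<le> a" "a \<le> b" "b \<le> T" for a b
    using that gint by (subst Henstock_Kurzweil_Integration.integral_combine) (auto intro: integrable_on_subinterval)
  have cont: "continuous_on {0..T} d"
    unfolding d_def by (intro continuous_intros u indefinite_integral_continuous_1 gint)
  have const: "d b = d a" if "0 < a" "a < b" "b < T" for a b
    using weak_derivative_imp_integral_interior[OF u g weak that] split[of a b] that
    by (simp add: d_def has_integral_iff)
  have "d t = d (T / 2)" if "t \<in> closure {0<..<T}" for t
  proof (rule continuous_constant_on_closure[OF _ _ that])
    show "continuous_on (closure {0<..<T}) d" using cont True by simp
    show "d x = d (T / 2)" if "x \<in> {0<..<T}" for x
    proof -
      from that have "0 < T / 2" "T / 2 < T" by auto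
      then show ?thesis using const[of x "T / 2"] const[of "T / 2" x] that
        by (metis greaterThanLessThan_iff linorder_less_linear)
    qed
  qed
  from this[of t] this[of s] have "d t = d s" using st True by simp
  then have "integral {s..t} g = u t - u s"
    using split[of s t] st by (simp add: d_def)
  moreover have "g integrable_on {s..t}" using gint st by (auto intro: integrable_on_subinterval)
  ultimately show ?thesis by (simp add: has_integral_iff)
next
  case False
  with st have "s = t" by simp
  then show ?thesis using has_integral_refl(2)[of g t] by simp
qed

section \<open>Piecewise differentiable functions as Sobolev functions\<close>

lemma bounded_integrable_Ioo:
  fixes g :: "real \<Rightarrow> real"
  assumes "g \<in> borel_measurable (lebesgue_on {a<..<b})" "\<And>t. t \<in> {a<..<b} \<Longrightarrow> \<bar>g t\<bar> \<le> M"
  shows "integrable (lebesgue_on {a<..<b}) g"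
proof -
  interpret finite_measure "lebesgue_on {a<..<b}"
    by (rule finite_measure_lebesgue_on) simp
  show ?thesis
    by (rule integrable_const_bound[where B = M]) (use assms in auto)
qed

lemma square_integrable_imp_integrable:
  assumes "square_integrable_on a b g"
  shows "integrable (lebesgue_on {a<..<b}) g"
proof -
  have "integrable (lebesgue_on {a<..<b}) (\<lambda>t. 1 + (g t)\<^sup>2)"
    using assms bounded_integrable_Ioo[of "\<lambda>_. 1" a b 1]
    by (auto simp: square_integrable_on_def)
  moreover have "\<bar>y\<bar> \<le> 1 + y\<^sup>2" for y :: real
    using zero_le_power2[of "\<bar>y\<bar> - 1"] by (simp add: power2_eq_square algebra_simps)
  ultimately show ?thesis
    using assms
    by (elim Bochner_Integration.integrable_bound) (auto simp: square_integrable_on_def)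
qed

lemma bounded_square_integrable:
  assumes "g \<in> borel_measurable (lebesgue_on {a<..<b})" "\<And>t. t \<in> {a<..<b} \<Longrightarrow> \<bar>g t\<bar> \<le> M"
  shows "square_integrable_on a b g"
  unfolding square_integrable_on_def
proof
  have "\<bar>(g t)\<^sup>2\<bar> \<le> M\<^sup>2" if "t \<in> {a<..<b}" for t
    using power_mono[OF assms(2)[OF that], of 2] by simp
  then show "integrable (lebesgue_on {a<..<b}) (\<lambda>t. (g t)\<^sup>2)"
    by (rule bounded_integrable_Ioo[OF borel_measurable_power[OF assms(1)]])
qed fact

text \<open>Integration by parts, with finitely many exceptional points tolerated by the fundamental
  theorem of calculus. The exceptions are needed because the speed has a corner at the stopping
  time.\<close>

lemma W12_deriv_piecewise:
  fixes u g :: "real \<Rightarrow> real"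
  assumes T: "0 < T" and "finite S" and u: "continuous_on {0..T} u"
    and D: "\<And>t. t \<in> {0<..<T} - S \<Longrightarrow> (u has_real_derivative g t) (at t)"
    and g: "g \<in> borel_measurable (lebesgue_on {0<..<T})" "\<And>t. t \<in> {0<..<T} \<Longrightarrow> \<bar>g t\<bar> \<le> M"
  shows "W12_deriv 0 T u g"
  unfolding W12_deriv_def
proof (intro conjI)
  have "bounded (u ` {0..T})"
    by (intro compact_imp_bounded compact_continuous_image u) simp
  then obtain B where "\<forall>t\<in>{0..T}. \<bar>u t\<bar> \<le> B" by (auto simp: bounded_iff)
  moreover have "u \<in> borel_measurable (lebesgue_on {0<..<T})"
    using u by (intro continuous_imp_measurable_on_sets_lebesgue) (auto intro: continuous_on_subset)
  ultimately show "square_integrable_on 0 T u"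
    by (intro bounded_square_integrable[where M = B]) auto
  show "square_integrable_on 0 T g" using g by (rule bounded_square_integrable)
  show "weak_derivative 0 T u g"
    unfolding weak_derivative_def
  proof (intro allI impI)
    fix \<psi> assume "test_function 0 T \<psi>"
    then have \<psi>: "\<psi> differentiable_on UNIV" "continuous_on UNIV (deriv \<psi>)"
      and supp: "closure {t. \<psi> t \<noteq> 0} \<subseteq> {0<..<T}" by (auto simp: test_function_def)
    have D\<psi>: "(\<psi> has_real_derivative deriv \<psi> t) (at t)" for t
      using \<psi>(1) by (auto simp: differentiable_on_def real_differentiable_def DERIV_deriv_iff_real_differentiable)
    have zero: "\<psi> t = 0" if "t \<notin> {0<..<T}" for t
      using supp closure_subset[of "{t. \<psi> t \<noteq> 0}"] that by blast
    have cont\<psi>: "continuous_on {0..T} \<psi>"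
      using D\<psi> by (meson DERIV_isCont continuous_at_imp_continuous_on)
    have contd: "continuous_on {0..T} (\<lambda>t. u t * deriv \<psi> t)"
      using u \<psi>(2) by (intro continuous_on_mult) (auto intro: continuous_on_subset)
    have "((\<lambda>t. g t * \<psi> t + u t * deriv \<psi> t) has_integral u T * \<psi> T - u 0 * \<psi> 0) {0..T}"
    proof (rule fundamental_theorem_of_calculus_interior_strong[OF \<open>finite S\<close>])
      fix t assume "t \<in> {0<..<T} - S"
      from DERIV_mult[OF D[OF this] D\<psi>]
      show "((\<lambda>t. u t * \<psi> t) has_vector_derivative g t * \<psi> t + u t * deriv \<psi> t) (at t)"
        by (simp add: has_real_derivative_iff_has_vector_derivative[symmetric] mult.commute add.commute)
    qed (use T in \<open>auto intro!: continuous_intros u cont\<psi>\<close>)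
    then have I: "((\<lambda>t. g t * \<psi> t + u t * deriv \<psi> t) has_integral 0) {0..T}"
      by (simp add: zero)
    have "bounded (\<psi> ` {0..T})"
      by (intro compact_imp_bounded compact_continuous_image cont\<psi>) simp
    then obtain C where C: "\<forall>t\<in>{0..T}. \<bar>\<psi> t\<bar> \<le> C" by (auto simp: bounded_iff)
    have ig: "integrable (lebesgue_on {0<..<T}) (\<lambda>t. g t * \<psi> t)"
    proof (rule bounded_integrable_Ioo)
      show "(\<lambda>t. g t * \<psi> t) \<in> borel_measurable (lebesgue_on {0<..<T})"
        using cont\<psi> by (intro borel_measurable_times g continuous_imp_measurable_on_sets_lebesgue)
          (auto intro: continuous_on_subset)
      fix t assume t: "t \<in> {0<..<T}"
      have "\<bar>g t\<bar> * \<bar>\<psi> t\<bar> \<le> M * C"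
        using g(2)[OF t] C t by (intro mult_mono) auto
      then show "\<bar>g t * \<psi> t\<bar> \<le> M * C" by (simp add: abs_mult)
    qed
    have "((\<lambda>t. g t * \<psi> t) has_integral (LINT t|lebesgue_on {0<..<T}. g t * \<psi> t)) {0..T}"
      using has_integral_integral_lebesgue_on[OF ig Ioo_sets_lebesgue]
        iffD1[OF has_integral_open_interval[where a = 0 and b = T, unfolded box_real]] by blast
    moreover have "((\<lambda>t. u t * deriv \<psi> t) has_integral (LINT t|lebesgue_on {0<..<T}. u t * deriv \<psi> t)) {0..T}"
      by (simp add: continuous_integrable_Ioo[OF contd] integrable_continuous_interval[OF contd] has_integral_iff)
    ultimately have "0 = (LINT t|lebesgue_on {0<..<T}. g t * \<psi> t) + (LINT t|lebesgue_on {0<..<T}. u t * deriv \<psi> t)"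
      by (intro has_integral_unique[OF I] has_integral_add)
    then show "(LINT t|lebesgue_on {0<..<T}. u t * deriv \<psi> t) = - (LINT t|lebesgue_on {0<..<T}. g t * \<psi> t)"
      by linarith
  qed
qed

section \<open>Uniqueness of strong solutions\<close>

lemma has_integral_le_spike:
  fixes f g :: "real \<Rightarrow> real"
  assumes "(f has_integral i) S" "(g has_integral j) S" "negligible N"
    and le: "\<And>x. x \<in> S - N \<Longrightarrow> f x \<le> g x"
  shows "i \<le> j"
proof (rule has_integral_le)
  show "((\<lambda>x. if x \<in> N then g x else f x) has_integral i) S"
    using assms(3) _ assms(1) by (rule has_integral_spike) auto
qed (use assms in auto)

text \<open>With \<open>E\<close> the primitive of \<open>e\<close>, the hypothesis says E' \<le> K
  E, so exp(-K t) E(t) is nonincreasing and starts at 0.\<close>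

lemma gronwall_zero:
  fixes e :: "real \<Rightarrow> real"
  assumes e: "continuous_on {0..T} e" and "\<And>t. t \<in> {0..T} \<Longrightarrow> 0 \<le> e t"
    and le: "\<And>t. t \<in> {0..T} \<Longrightarrow> e t \<le> K * integral {0..t} e" and "K \<ge> 0" and t: "t \<in> {0..T}"
  shows "e t = 0"
proof -
  define E where "E = (\<lambda>t. integral {0..t} e)"
  have contE: "continuous_on {0..T} E"
    unfolding E_def by (intro indefinite_integral_continuous_1 integrable_continuous_interval e)
  have "exp (- K * t) * E t \<le> exp (- K * 0) * E 0"
  proof (rule DERIV_nonpos_imp_decreasing_open[of 0 t "\<lambda>t. exp (- K * t) * E t"])
    show "0 \<le> t" using t by simp
    show "continuous_on {0..t} (\<lambda>t. exp (- K * t) * E t)"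
      using t by (intro continuous_intros continuous_on_subset[OF contE]) auto
    fix s assume s: "0 < s" "s < t"
    have "(E has_real_derivative e s) (at s within {0..T})"
      unfolding E_def using s t by (intro integral_has_real_derivative e) auto
    then have "(E has_real_derivative e s) (at s)"
      using s t by (simp add: at_within_interior[of s "{0..T}"])
    then have "((\<lambda>t. exp (- K * t) * E t) has_real_derivative exp (- K * s) * (e s - K * E s)) (at s)"
      by (auto intro!: derivative_eq_intros simp: algebra_simps)
    moreover have "exp (- K * s) * (e s - K * E s) \<le> 0"
      using le[of s] s t by (intro mult_nonneg_nonpos) (auto simp: E_def)
    ultimately show "\<exists>y. ((\<lambda>t. exp (- K * t) * E t) has_real_derivative y) (at s) \<and> y \<le> 0" by blast
  qed
  then have "E t \<le> 0" by (simp add: E_def mult_le_0_iff)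
  then have "K * E t \<le> 0" using \<open>K \<ge> 0\<close> by (simp add: mult_nonneg_nonpos)
  with le[OF t] assms(2)[OF t] show ?thesis by (simp add: E_def)
qed

lemma subdifferential_mono:
  assumes "\<xi> \<in> subdifferential \<phi> v" "\<eta> \<in> subdifferential \<phi> w" "w < v"
  shows "\<eta> \<le> \<xi>"
proof -
  have "\<phi> v + \<xi> * (w - v) \<le> \<phi> w" "\<phi> w + \<eta> * (v - w) \<le> \<phi> v"
    using assms by (auto simp: subdifferential_def)
  then have "\<eta> * (v - w) \<le> \<xi> * (v - w)" by (simp add: algebra_simps)
  then show ?thesis using assms(3) by simp
qed

text \<open>Eliminates the weak derivatives: increments of \<open>x\<close> and \<open>v\<close>
  become integrals, and the inclusion holds off a single null set. Uniqueness uses nothing else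
  about strong solutions.\<close>

lemma strong_solution_integral_equation:
  assumes "strong_solution \<gamma> \<phi> F x0 v0 T x v"
  obtains dv \<xi> N where "negligible N"
    and "\<And>s t. 0 \<le> s \<Longrightarrow> s \<le> t \<Longrightarrow> t \<le> T \<Longrightarrow> (v has_integral x t - x s) {s..t}"
    and "\<And>s t. 0 \<le> s \<Longrightarrow> s \<le> t \<Longrightarrow> t \<le> T \<Longrightarrow> (dv has_integral v t - v s) {s..t}"
    and "\<And>t. t \<in> {0..T} - N \<Longrightarrow> \<xi> t \<in> subdifferential \<phi> (v t) \<and> dv t + \<gamma> * v t + \<xi> t + F (x t) (v t) = 0"
proof -
  from assms obtain dx dv \<xi> where cont: "continuous_on {0..T} x" "continuous_on {0..T} v"
    and W: "W12_deriv 0 T x dx" "W12_deriv 0 T v dv"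
    and ae: "AE t in lebesgue_on {0<..<T}. v t = dx t \<and> \<xi> t \<in> subdifferential \<phi> (v t)
        \<and> dv t + \<gamma> * v t + \<xi> t + F (x t) (v t) = 0"
    unfolding strong_solution_def by blast
  from ae obtain N where N: "N \<in> null_sets (lebesgue_on {0<..<T})"
    and eq: "\<And>t. t \<in> {0<..<T} - N \<Longrightarrow> v t = dx t \<and> \<xi> t \<in> subdifferential \<phi> (v t)
        \<and> dv t + \<gamma> * v t + \<xi> t + F (x t) (v t) = 0"
    unfolding eventually_ae_filter space_lebesgue_on by blast
  \<comment> \<open>The endpoints join the null set, since the almost-everywhere statement concerns
    the open interval only.\<close>
  define N' where "N' = N \<union> {0, T}"
  have "negligible N'"
    using N by (auto simp: N'_def null_sets_restrict_space negligible_iff_null_sets)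
  moreover have eq': "v t = dx t \<and> \<xi> t \<in> subdifferential \<phi> (v t)
        \<and> dv t + \<gamma> * v t + \<xi> t + F (x t) (v t) = 0" if "t \<in> {0..T} - N'" for t
    using that eq[of t] by (force simp: N'_def)
  moreover have "(dv has_integral v t - v s) {s..t}" if "0 \<le> s" "s \<le> t" "t \<le> T" for s t
    using W(2) that cont
    by (intro weak_derivative_imp_integral[of T]) (auto simp: W12_deriv_def intro: square_integrable_imp_integrable)
  moreover have "(v has_integral x t - x s) {s..t}" if st: "0 \<le> s" "s \<le> t" "t \<le> T" for s t
  proof (rule has_integral_spike[OF \<open>negligible N'\<close>])
    show "(dx has_integral x t - x s) {s..t}"
      using W(1) that cont
      by (intro weak_derivative_imp_integral[of T]) (auto simp: W12_deriv_def intro: square_integrable_imp_integrable)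
  qed (use eq' st in auto)
  ultimately show thesis using that by blast
qed

text \<open>A global Lipschitz condition would exclude the explicit force: the product of f''(x) and
  v has a Lipschitz constant in x that grows with |v|.\<close>

definition locally_lipschitz :: "(real \<Rightarrow> real \<Rightarrow> real) \<Rightarrow> bool" where
  "locally_lipschitz F \<longleftrightarrow> (\<forall>R. \<exists>L\<ge>0. \<forall>x y v w. \<bar>x\<bar> \<le> R \<longrightarrow> \<bar>y\<bar> \<le> R \<longrightarrow> \<bar>v\<bar> \<le> R \<longrightarrow> \<bar>w\<bar> \<le> R \<longrightarrow>
     \<bar>F x v - F y w\<bar> \<le> L * (\<bar>x - y\<bar> + \<bar>v - w\<bar>))"

text \<open>After the last time at which \<open>v \<le> w\<close> the friction terms are ordered by monotonicity, so only
  the Lipschitz force can increase \<open>v - w\<close>; this replaces the energy estimate for \<open>(v - w)\<^sup>2\<close>.\<close>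

lemma strong_solution_velocity_le:
  assumes "\<gamma> \<ge> 0" and sol: "strong_solution \<gamma> \<phi> F x0 v0 T x v" "strong_solution \<gamma> \<phi> F x0 v0 T y w"
    and L: "L \<ge> 0" "\<And>t. t \<in> {0..T} \<Longrightarrow> \<bar>F (x t) (v t) - F (y t) (w t)\<bar> \<le> L * (\<bar>x t - y t\<bar> + \<bar>v t - w t\<bar>)"
    and t: "t \<in> {0..T}"
  shows "v t - w t \<le> L * integral {0..t} (\<lambda>t. \<bar>x t - y t\<bar> + \<bar>v t - w t\<bar>)"
proof -
  let ?e = "\<lambda>t. \<bar>x t - y t\<bar> + \<bar>v t - w t\<bar>"
  have cont: "continuous_on {0..T} x" "continuous_on {0..T} v" "continuous_on {0..T} y" "continuous_on {0..T} w"
    and init: "v 0 = w 0"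
    using sol by (auto simp: strong_solution_def)
  have conte: "continuous_on {0..T} ?e" by (intro continuous_intros cont)
  have inte: "?e integrable_on {a..b}" if "0 \<le> a" "b \<le> T" for a b
    by (intro integrable_continuous_interval continuous_on_subset[OF conte]) (use that in auto)
  obtain dv \<xi> N where N: "negligible N"
    and dv: "\<And>s t. 0 \<le> s \<Longrightarrow> s \<le> t \<Longrightarrow> t \<le> T \<Longrightarrow> (dv has_integral v t - v s) {s..t}"
    and \<xi>: "\<And>t. t \<in> {0..T} - N \<Longrightarrow> \<xi> t \<in> subdifferential \<phi> (v t) \<and> dv t + \<gamma> * v t + \<xi> t + F (x t) (v t) = 0"
    by (rule strong_solution_integral_equation[OF sol(1)]) blast
  obtain dw \<eta> N' where N': "negligible N'"
    and dw: "\<And>s t. 0 \<le> s \<Longrightarrow> s \<le> t \<Longrightarrow> t \<le> T \<Longrightarrow> (dw has_integral w t - w s) {s..t}"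
    and \<eta>: "\<And>t. t \<in> {0..T} - N' \<Longrightarrow> \<eta> t \<in> subdifferential \<phi> (w t) \<and> dw t + \<gamma> * w t + \<eta> t + F (y t) (w t) = 0"
    by (rule strong_solution_integral_equation[OF sol(2)]) blast
  \<comment> \<open>The set contains 0 because the initial velocities agree, and it is closed, so
    its supremum is a last time with v \<le> w.\<close>
  define A where "A = {s \<in> {0..t}. v s - w s \<le> 0}"
  have "closed A"
    unfolding A_def
    by (intro continuous_on_closed_Collect_le continuous_intros continuous_on_subset[OF cont(2)]
        continuous_on_subset[OF cont(4)]) (use t in auto)
  moreover have "0 \<in> A" using init t by (simp add: A_def)
  moreover have bdd: "bdd_above A" by (auto simp: A_def)
  ultimately have "Sup A \<in> A" by (intro closed_contains_Sup) auto
  then obtain s where s: "s \<in> A" "s = Sup A" by blast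
  then have st: "0 \<le> s" "s \<le> t" "v s \<le> w s" by (auto simp: A_def)
  have pos: "w \<tau> < v \<tau>" if "\<tau> \<in> {s<..t}" for \<tau>
  proof (rule ccontr)
    assume "\<not> w \<tau> < v \<tau>"
    with that st have "\<tau> \<in> A" by (auto simp: A_def)
    then have "\<tau> \<le> s" unfolding s(2) using bdd by (rule cSup_upper)
    with that show False by simp
  qed
  have "(v t - v s) - (w t - w s) \<le> L * integral {s..t} ?e"
  proof (rule has_integral_le_spike)
    show "((\<lambda>\<tau>. dv \<tau> - dw \<tau>) has_integral (v t - v s) - (w t - w s)) {s..t}"
      using st t by (intro has_integral_diff dv dw) auto
    show "((\<lambda>\<tau>. L * ?e \<tau>) has_integral L * integral {s..t} ?e) {s..t}"
      using st t by (intro has_integral_mult_right integrable_integral inte) auto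
    show "negligible (N \<union> N' \<union> {s})" using N N' by simp
    fix \<tau> assume \<tau>: "\<tau> \<in> {s..t} - (N \<union> N' \<union> {s})"
    then have "\<tau> \<in> {0..T} - N" "\<tau> \<in> {0..T} - N'" using st t by auto
    note * = \<xi>[OF this(1)] \<eta>[OF this(2)]
    have less: "w \<tau> < v \<tau>" using \<tau> by (intro pos) auto
    then have "\<eta> \<tau> \<le> \<xi> \<tau>" using * subdifferential_mono by blast
    moreover have "\<gamma> * w \<tau> \<le> \<gamma> * v \<tau>" using less \<open>\<gamma> \<ge> 0\<close> by (intro mult_left_mono) auto
    moreover have "\<bar>F (x \<tau>) (v \<tau>) - F (y \<tau>) (w \<tau>)\<bar> \<le> L * ?e \<tau>"
      using \<tau> st t by (intro L(2)) auto
    ultimately show "dv \<tau> - dw \<tau> \<le> L * ?e \<tau>" using * by linarith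
  qed
  also have "\<dots> \<le> L * integral {0..t} ?e"
    using st t L(1) by (intro mult_left_mono integral_subset_le inte) auto
  finally show ?thesis using st by linarith
qed

text \<open>The one-sided velocity estimate is used with both orders of the solutions, and the
  position gap is the integral of the velocity gap. The sum of both gaps then satisfies a Gronwall
  inequality without source.\<close>

lemma strong_solution_unique:
  assumes "\<gamma> \<ge> 0" and F: "locally_lipschitz F"
    and sol: "strong_solution \<gamma> \<phi> F x0 v0 T x v" "strong_solution \<gamma> \<phi> F x0 v0 T y w"
    and t: "t \<in> {0..T}"
  shows "x t = y t \<and> v t = w t"
proof -
  let ?e = "\<lambda>t. \<bar>x t - y t\<bar> + \<bar>v t - w t\<bar>"
  have cont: "continuous_on {0..T} x" "continuous_on {0..T} v" "continuous_on {0..T} y" "continuous_on {0..T} w"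
    and init: "x 0 = y 0"
    using sol by (auto simp: strong_solution_def)
  have conte: "continuous_on {0..T} ?e" by (intro continuous_intros cont)
  have inte: "?e integrable_on {0..t}" if "t \<le> T" for t
    by (intro integrable_continuous_interval continuous_on_subset[OF conte]) (use that in auto)
  have "bounded ((x ` {0..T} \<union> y ` {0..T}) \<union> (v ` {0..T} \<union> w ` {0..T}))"
    by (intro bounded_Un[THEN iffD2] conjI compact_imp_bounded compact_continuous_image cont) auto
  then obtain R where "\<forall>z\<in>(x ` {0..T} \<union> y ` {0..T}) \<union> (v ` {0..T} \<union> w ` {0..T}). \<bar>z\<bar> \<le> R"
    unfolding bounded_iff by auto
  then have R: "\<forall>t\<in>{0..T}. \<bar>x t\<bar> \<le> R \<and> \<bar>y t\<bar> \<le> R \<and> \<bar>v t\<bar> \<le> R \<and> \<bar>w t\<bar> \<le> R"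
    by blast
  obtain L where L: "L \<ge> 0" "\<And>x y v w. \<bar>x\<bar> \<le> R \<Longrightarrow> \<bar>y\<bar> \<le> R \<Longrightarrow> \<bar>v\<bar> \<le> R \<Longrightarrow> \<bar>w\<bar> \<le> R \<Longrightarrow>
     \<bar>F x v - F y w\<bar> \<le> L * (\<bar>x - y\<bar> + \<bar>v - w\<bar>)"
    using F unfolding locally_lipschitz_def by meson
  have "\<bar>v t - w t\<bar> \<le> L * integral {0..t} ?e" if t: "t \<in> {0..T}" for t
  proof -
    have "v t - w t \<le> L * integral {0..t} ?e"
      by (rule strong_solution_velocity_le[OF \<open>\<gamma> \<ge> 0\<close> sol L(1) _ t]) (use L(2) R in blast)
    moreover have "w t - v t \<le> L * integral {0..t} (\<lambda>t. \<bar>y t - x t\<bar> + \<bar>w t - v t\<bar>)"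
      by (rule strong_solution_velocity_le[OF \<open>\<gamma> \<ge> 0\<close> sol(2,1) L(1) _ t]) (use L(2) R in blast)
    ultimately show ?thesis by (simp add: abs_minus_commute)
  qed
  moreover have "\<bar>x t - y t\<bar> \<le> integral {0..t} ?e" if t: "t \<in> {0..T}" for t
  proof -
    have *: "(v has_integral x t - x 0) {0..t}" if "strong_solution \<gamma> \<phi> F x0 v0 T x v" for x v
      by (rule strong_solution_integral_equation[OF that]) (use t in auto)
    have I: "((\<lambda>t. v t - w t) has_integral x t - y t) {0..t}"
      using has_integral_diff[OF *[OF sol(1)] *[OF sol(2)]] init by simp
    then have "norm (integral {0..t} (\<lambda>t. v t - w t)) \<le> integral {0..t} ?e"
      using t by (intro integral_norm_bound_integral inte) auto
    with I show ?thesis by (simp add: integral_unique)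
  qed
  ultimately have le: "?e t \<le> (1 + L) * integral {0..t} ?e" if "t \<in> {0..T}" for t
    using that by (simp add: distrib_right add_mono)
  have "?e t = 0"
    by (rule gronwall_zero[OF conte _ le _ t]) (use L(1) in auto)
  then show ?thesis by linarith
qed

lemma the_global_strong_solutionI:
  assumes "\<gamma> \<ge> 0" "locally_lipschitz F" "global_strong_solution \<gamma> \<phi> F x0 v0 x v"
  shows "the_global_strong_solution \<gamma> \<phi> F x0 v0 x v"
  unfolding the_global_strong_solution_def
proof (intro conjI allI impI)
  fix y w and t :: real assume "global_strong_solution \<gamma> \<phi> F x0 v0 y w" "0 \<le> t"
  \<comment> \<open>The horizon \<open>t + 1\<close> is positive even for \<open>t = 0\<close>, as
    the definition of a global solution requires.\<close>
  with assms have "y t = x t \<and> w t = v t"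
    by (intro strong_solution_unique[of \<gamma> F \<phi> x0 v0 "t + 1"]) (auto simp: global_strong_solution_def)
  then show "y t = x t" "w t = v t" by auto
qed fact

section \<open>Parametrising a trajectory by its speed\<close>

lemma integral_le_const:
  fixes f :: "real \<Rightarrow> real"
  assumes "continuous_on {a..b} f" "0 \<le> a" "a \<le> b" "b \<le> 1" "0 \<le> c"
    and "\<And>w. w \<in> {a..b} \<Longrightarrow> \<bar>f w\<bar> \<le> c"
  shows "\<bar>integral {a..b} f\<bar> \<le> c"
proof -
  have "norm (integral {a..b} f) \<le> c * (b - a)"
    using assms by (intro integral_bound) auto
  also have "\<dots> \<le> c" using assms by (intro mult_left_le) auto
  finally show ?thesis by simp
qed

lemma continuous_on_backward_integral:
  fixes f :: "real \<Rightarrow> real"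
  assumes "continuous_on {0..1} f"
  shows "continuous_on {0..1} (\<lambda>v. integral {v..1} f)"
  using assms by (intro indefinite_integral_continuous_1' integrable_continuous_interval)

text \<open>The interval has length 1, so a Lipschitz constant 1/2 of the integrand is already the
  contraction factor in the supremum norm, without any exponential weight. Integration runs backward
  because the initial speed is the right end \<open>v = 1\<close>.\<close>

lemma backward_picard:
  fixes h :: "real \<Rightarrow> real \<Rightarrow> real"
  assumes h: "continuous_on ({0..1} \<times> UNIV) (\<lambda>(w, x). h w x)"
    and lip: "\<And>w x y. w \<in> {0..1} \<Longrightarrow> \<bar>h w x - h w y\<bar> \<le> \<bar>x - y\<bar> / 2"
  obtains X where "continuous_on {0..1} X" "\<And>v. v \<in> {0..1} \<Longrightarrow> X v = integral {v..1} (\<lambda>w. h w (X w))"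
proof -
  \<comment> \<open>Clamping to \<open>{0..1}\<close> extends the candidates to the whole line, the
    domain of the complete space of bounded continuous functions in which the fixed point is
    sought.\<close>
  define c where "c = (\<lambda>v::real. max 0 (min 1 v))"
  have c: "c v \<in> {0..1}" "continuous_on S c" for v S
    unfolding c_def by (auto intro!: continuous_intros)
  define I where "I = (\<lambda>X v. integral {c v..1} (\<lambda>w. h w (X w)))"
  have conth: "continuous_on {0..1} (\<lambda>w. h w (X w))" if "continuous_on {0..1} X" for X
    using continuous_on_compose2[OF h, of "{0..1}" "\<lambda>w. (w, X w)"] that
    by (force intro: continuous_on_Pair continuous_on_id)
  have contI: "continuous_on UNIV (I X)" if "continuous_on {0..1} X" for X
    unfolding I_def
    by (rule continuous_on_compose2[OF continuous_on_backward_integral[OF conth[OF that]] c(2)]) (use c in auto)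
  have bcont: "I X \<in> bcontfun" if X: "continuous_on {0..1} X" for X
  proof -
    have "bounded ((\<lambda>v. integral {v..1} (\<lambda>w. h w (X w))) ` {0..1})"
      by (intro compact_imp_bounded compact_continuous_image continuous_on_backward_integral conth X) simp
    then obtain B where "\<forall>v\<in>{0..1}. norm (integral {v..1} (\<lambda>w. h w (X w))) \<le> B" by (auto simp: bounded_iff)
    then have "norm (I X v) \<le> B" for v using c(1)[of v] unfolding I_def by blast
    then show ?thesis by (rule bcontfun_normI[OF contI[OF X]])
  qed
  define \<Phi> where "\<Phi> = (\<lambda>X::real \<Rightarrow>\<^sub>C real. Bcontfun (I X))"
  have \<Phi>: "apply_bcontfun (\<Phi> X) = I X" for X
    unfolding \<Phi>_def by (intro Bcontfun_inverse bcont continuous_on_apply_bcontfun)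
  have contr: "dist (\<Phi> X) (\<Phi> Y) \<le> 1 / 2 * dist X Y" for X Y
  proof (rule dist_bound)
    fix v
    have "I X v - I Y v = integral {c v..1} (\<lambda>w. h w (X w) - h w (Y w))"
      unfolding I_def using c(1)[of v]
      by (intro Henstock_Kurzweil_Integration.integral_diff[symmetric] integrable_continuous_interval continuous_on_subset[OF conth]) auto
    also have "\<bar>\<dots>\<bar> \<le> 1 / 2 * dist X Y"
    proof (rule integral_le_const)
      show "continuous_on {c v..1} (\<lambda>w. h w (X w) - h w (Y w))"
        using c(1)[of v] by (intro continuous_intros continuous_on_subset[OF conth]) auto
      fix w assume "w \<in> {c v..1}"
      then have "\<bar>h w (X w) - h w (Y w)\<bar> \<le> \<bar>X w - Y w\<bar> / 2" using c(1)[of v] by (intro lip) auto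
      then show "\<bar>h w (X w) - h w (Y w)\<bar> \<le> 1 / 2 * dist X Y"
        using dist_bounded[of X w Y] by (simp add: dist_real_def)
    qed (use c(1)[of v] in auto)
    finally show "dist (\<Phi> X v) (\<Phi> Y v) \<le> 1 / 2 * dist X Y" by (simp add: \<Phi> dist_real_def)
  qed
  have "\<exists>!X. \<Phi> X = X" by (rule banach_fix_type[of "1 / 2"]) (use contr in auto)
  then obtain X where X: "\<Phi> X = X" by blast
  show thesis
  proof
    show "continuous_on {0..1} (apply_bcontfun X)" by simp
    show "X v = integral {v..1} (\<lambda>w. h w (X w))" if "v \<in> {0..1}" for v
      using arg_cong[OF X, of "\<lambda>Y. apply_bcontfun Y v"] that by (simp add: \<Phi> I_def c_def)
  qed
qed

text \<open>At a point \<open>m\<close> where the gap is largest the hypothesis bounds the gap by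
  half of itself plus \<epsilon>, and the half is absorbed. This is the stability estimate behind
  every comparison of arcs below.\<close>

lemma backward_integral_close:
  fixes a b X Y :: "real \<Rightarrow> real"
  assumes cont: "continuous_on {0..1} a" "continuous_on {0..1} b"
    and X: "\<And>v. v \<in> {0..1} \<Longrightarrow> X v = integral {v..1} a"
    and Y: "\<And>v. v \<in> {0..1} \<Longrightarrow> Y v = integral {v..1} b"
    and close: "\<And>w. w \<in> {0..1} \<Longrightarrow> \<bar>a w - b w\<bar> \<le> \<bar>X w - Y w\<bar> / 2 + \<epsilon>"
    and v: "v \<in> {0..1}"
  shows "\<bar>X v - Y v\<bar> \<le> 2 * \<epsilon>"
proof -
  have "continuous_on {0..1} (\<lambda>v. \<bar>X v - Y v\<bar>)"
    using continuous_on_backward_integral[OF cont(1)] continuous_on_backward_integral[OF cont(2)]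
    by (subst continuous_on_cong[OF refl, where g = "\<lambda>v. \<bar>integral {v..1} a - integral {v..1} b\<bar>"])
       (auto simp: X Y intro!: continuous_intros)
  then obtain m where m: "m \<in> {0..1}" "\<And>v. v \<in> {0..1} \<Longrightarrow> \<bar>X v - Y v\<bar> \<le> \<bar>X m - Y m\<bar>"
    using continuous_attains_sup[of "{0..1::real}" "\<lambda>v. \<bar>X v - Y v\<bar>"] by auto
  have "X m - Y m = integral {m..1} (\<lambda>w. a w - b w)"
    using m(1) cont by (simp add: X Y, intro Henstock_Kurzweil_Integration.integral_diff[symmetric] integrable_continuous_interval)
      (auto intro: continuous_on_subset)
  also have "\<bar>\<dots>\<bar> \<le> \<bar>X m - Y m\<bar> / 2 + \<epsilon>"
  proof (rule integral_le_const)
    show "continuous_on {m..1} (\<lambda>w. a w - b w)"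
      using m(1) cont by (auto intro!: continuous_intros intro: continuous_on_subset)
    show "0 \<le> \<bar>X m - Y m\<bar> / 2 + \<epsilon>" using close[OF m(1)] by linarith
    fix w assume "w \<in> {m..1}"
    then have "w \<in> {0..1}" using m(1) by auto
    then show "\<bar>a w - b w\<bar> \<le> \<bar>X m - Y m\<bar> / 2 + \<epsilon>" using close[of w] m(2)[of w] by auto
  qed (use m in auto)
  finally have "\<bar>X m - Y m\<bar> \<le> 2 * \<epsilon>" by (simp add: field_simps)
  with m(2)[OF v] show ?thesis by (rule order_trans)
qed

section \<open>Dry friction and the sliding arc\<close>

lemma subdifferential_friction_pos:
  assumes "r > 0" "v > 0"
  shows "r \<in> subdifferential (\<lambda>v. r * \<bar>v\<bar>) v"
  using assms by (auto simp: subdifferential_def simp flip: distrib_left intro!: mult_left_mono)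

lemma subdifferential_friction_zero:
  assumes "r > 0"
  shows "subdifferential (\<lambda>v. r * \<bar>v\<bar>) 0 = {-r..r}"
proof (intro equalityI subsetI)
  fix \<xi> assume "\<xi> \<in> subdifferential (\<lambda>v. r * \<bar>v\<bar>) 0"
  then have *: "\<xi> * w \<le> r * \<bar>w\<bar>" for w by (simp add: subdifferential_def)
  show "\<xi> \<in> {-r..r}" using *[of 1] *[of "-1"] by simp
next
  fix \<xi> assume "\<xi> \<in> {-r..r}"
  then have "\<xi> * w \<le> r * \<bar>w\<bar>" for w
    using mult_right_mono[of "\<bar>\<xi>\<bar>" r "\<bar>w\<bar>"] abs_ge_self[of "\<xi> * w"] by (auto simp: abs_mult abs_le_iff)
  then show "\<xi> \<in> subdifferential (\<lambda>v. r * \<bar>v\<bar>) 0" by (simp add: subdifferential_def)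
qed

text \<open>While it decelerates from speed 1 to 0 the trajectory is parametrised by its speed \<open>w\<close>:
  \<open>X w\<close> is the position at speed \<open>w\<close>, \<open>slowness w\<close> is \<open>- dt / dw\<close> and \<open>clock v\<close> is the time at
  which the speed drops to \<open>v\<close>. This turns the unknown stopping time into an integral over a
  fixed interval.\<close>

locale sliding_arc =
  fixes \<gamma> r :: real and F :: "real \<Rightarrow> real \<Rightarrow> real" and X :: "real \<Rightarrow> real"
  assumes \<gamma>: "\<gamma> > 0" and r: "r > 0"
    and F_cont: "continuous_on ({0..} \<times> {0..1}) (\<lambda>(x, w). F x w)"
    and F_nonneg: "\<And>x w. 0 \<le> x \<Longrightarrow> w \<in> {0..1} \<Longrightarrow> 0 \<le> F x w"
    and F_stick: "\<And>x. 0 \<le> x \<Longrightarrow> x \<le> 1 / r \<Longrightarrow> F x 0 \<le> r"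
    and X_cont: "continuous_on {0..1} X"
    and X_nonneg: "\<And>v. v \<in> {0..1} \<Longrightarrow> 0 \<le> X v"
    and X_eq: "\<And>v. v \<in> {0..1} \<Longrightarrow> X v = integral {v..1} (\<lambda>w. w * (1 / (\<gamma> * w + r + F (X w) w)))"
begin

definition slowness :: "real \<Rightarrow> real" where
  "slowness w = 1 / (\<gamma> * w + r + F (X w) w)"

definition clock :: "real \<Rightarrow> real" where
  "clock v = integral {v..1} slowness"

text \<open>The inverse of the clock. Capping the time at \<open>clock 0\<close> makes the particle
  stick at speed 0 from then on.\<close>

definition speed :: "real \<Rightarrow> real" where
  "speed t = the_inv_into {0..1} clock (min t (clock 0))"

definition position :: "real \<Rightarrow> real" where
  "position t = X (speed t)"

lemma deceleration_ge: "w \<in> {0..1} \<Longrightarrow> r \<le> \<gamma> * w + r + F (X w) w"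
  using \<gamma> X_nonneg[of w] F_nonneg[of "X w" w] by simp

lemma slowness_bounds:
  assumes "w \<in> {0..1}"
  shows "0 < slowness w" "slowness w \<le> 1 / r"
  using deceleration_ge[OF assms] r by (auto simp: slowness_def intro!: divide_left_mono)

lemma slowness_cont: "continuous_on {0..1} slowness"
  unfolding slowness_def
proof (intro continuous_intros)
  show "continuous_on {0..1} (\<lambda>w. F (X w) w)"
    using continuous_on_compose2[OF F_cont, of "{0..1}" "\<lambda>w. (X w, w)"] X_nonneg
    by (force intro: continuous_on_Pair continuous_on_id X_cont)
qed (use deceleration_ge r in force)

lemma X_eq': "v \<in> {0..1} \<Longrightarrow> X v = integral {v..1} (\<lambda>w. w * slowness w)"
  using X_eq by (simp add: slowness_def)

text \<open>Speed at most 1 and slowness at most \<open>1 / r\<close> limit the path. The range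
  obtained is the one on which \<open>F_stick\<close> is assumed, so the particle can stick where it
  comes to rest.\<close>

lemma X_le: "v \<in> {0..1} \<Longrightarrow> X v \<le> 1 / r"
proof -
  assume v: "v \<in> {0..1}"
  have "\<bar>integral {v..1} (\<lambda>w. w * slowness w)\<bar> \<le> 1 / r"
  proof (rule integral_le_const)
    fix w assume "w \<in> {v..1}"
    then show "\<bar>w * slowness w\<bar> \<le> 1 / r"
      using slowness_bounds[of w] v mult_mono[of w 1 "slowness w" "1 / r"] by (auto simp: abs_mult)
  qed (use v r in \<open>auto intro!: continuous_intros continuous_on_subset[OF slowness_cont]\<close>)
  then show ?thesis using X_eq'[OF v] by linarith
qed

lemma clock_cont: "continuous_on {0..1} clock"
  unfolding clock_def by (rule continuous_on_backward_integral[OF slowness_cont])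

lemma has_real_derivative_clock:
  assumes "v \<in> {0<..<1}"
  shows "(clock has_real_derivative - slowness v) (at v)"
proof -
  have "(clock has_real_derivative - slowness v) (at v within {0..1})"
    unfolding clock_def using assms by (intro integral_has_real_derivative' slowness_cont) auto
  then show ?thesis using assms by (simp add: at_within_interior[of v "{0..1}"])
qed

lemma has_real_derivative_X:
  assumes "v \<in> {0<..<1}"
  shows "(X has_real_derivative - (v * slowness v)) (at v)"
proof -
  have "((\<lambda>v. integral {v..1} (\<lambda>w. w * slowness w)) has_real_derivative - (v * slowness v)) (at v within {0..1})"
    using assms by (intro integral_has_real_derivative' continuous_intros slowness_cont) auto
  then have "(X has_real_derivative - (v * slowness v)) (at v within {0..1})"
    by (rule has_field_derivative_transform_within[where d = 1]) (use assms X_eq' in auto)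
  then show ?thesis using assms by (simp add: at_within_interior[of v "{0..1}"])
qed

text \<open>Converts a difference of clock readings into a difference of speeds. The points are left
  unordered because it is not known in advance which scheme is faster at a given time.\<close>

lemma clock_mvt:
  assumes "a \<in> {0..1}" "b \<in> {0..1}"
  obtains \<xi> where "min a b \<le> \<xi>" "\<xi> \<le> max a b" "clock a - clock b = slowness \<xi> * (b - a)"
proof -
  have mvt: "\<exists>\<xi>. a < \<xi> \<and> \<xi> < b \<and> clock b - clock a = (b - a) * (- slowness \<xi>)"
    if "0 \<le> a" "a < b" "b \<le> 1" for a b
  proof -
    have "\<exists>l z. a < z \<and> z < b \<and> (clock has_real_derivative l) (at z) \<and> clock b - clock a = (b - a) * l"
    proof (intro MVT that(2) continuous_on_subset[OF clock_cont])
      show "clock differentiable at x" if "a < x" "x < b" for x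
        using has_real_derivative_clock[of x] that \<open>0 \<le> a\<close> \<open>b \<le> 1\<close>
        by (auto simp: real_differentiable_def)
    qed (use that in auto)
    then obtain l z where z: "a < z" "z < b" "(clock has_real_derivative l) (at z)"
      "clock b - clock a = (b - a) * l" by blast
    then have "l = - slowness z"
      using that by (intro DERIV_unique[OF z(3)] has_real_derivative_clock) auto
    with z show ?thesis by blast
  qed
  consider "a < b" | "a = b" | "b < a" by linarith
  then show thesis
  proof cases
    case 1
    then obtain \<xi> where "a < \<xi>" "\<xi> < b" "clock b - clock a = (b - a) * (- slowness \<xi>)"
      using mvt[of a b] assms by auto
    then show thesis using 1 by (intro that[of \<xi>]) (auto simp: algebra_simps)
  next
    case 2
    then show thesis by (intro that[of a]) auto
  next
    case 3
    then obtain \<xi> where "b < \<xi>" "\<xi> < a" "clock a - clock b = (a - b) * (- slowness \<xi>)"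
      using mvt[of b a] assms by auto
    then show thesis using 3 by (intro that[of \<xi>]) (auto simp: algebra_simps)
  qed
qed

lemma clock_less: "0 \<le> a \<Longrightarrow> a < b \<Longrightarrow> b \<le> 1 \<Longrightarrow> clock b < clock a"
proof -
  assume *: "0 \<le> a" "a < b" "b \<le> 1"
  show ?thesis
  proof (rule DERIV_neg_imp_decreasing_open[OF *(2)])
    fix x assume "a < x" "x < b"
    then show "\<exists>y. (clock has_real_derivative y) (at x) \<and> y < 0"
      using * has_real_derivative_clock[of x] slowness_bounds[of x] by force
  qed (use * in \<open>auto intro: continuous_on_subset[OF clock_cont]\<close>)
qed

lemma clock_1 [simp]: "clock 1 = 0"
  by (simp add: clock_def)

lemma clock_0_pos: "clock 0 > 0"
  using clock_less[of 0 1] by simp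

lemma clock_inj: "inj_on clock {0..1}"
  by (rule inj_onI) (metis atLeastAtMost_iff clock_less less_irrefl linorder_neqE_linordered_idom)

lemma clock_image: "clock ` {0..1} = {0..clock 0}"
proof (intro equalityI subsetI)
  fix t assume "t \<in> clock ` {0..1}"
  then obtain v where "t = clock v" "v \<in> {0..1}" by blast
  then show "t \<in> {0..clock 0}"
    using clock_less[of 0 v] clock_less[of v 1] by (cases "v = 0"; cases "v = 1") auto
next
  fix t assume "t \<in> {0..clock 0}"
  then have "\<exists>v\<ge>0. v \<le> 1 \<and> clock v = t" by (intro IVT2' clock_cont) auto
  then show "t \<in> clock ` {0..1}" by auto
qed

lemma speed_in: "0 \<le> t \<Longrightarrow> speed t \<in> {0..1}"
  unfolding speed_def using clock_0_pos by (intro the_inv_into_into[OF clock_inj]) (auto simp: clock_image)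

lemma speed_image: "A \<subseteq> {0..} \<Longrightarrow> speed ` A \<subseteq> {0..1}"
  using speed_in by fast

lemma clock_speed: "0 \<le> t \<Longrightarrow> clock (speed t) = min t (clock 0)"
  unfolding speed_def using clock_0_pos by (intro f_the_inv_into_f[OF clock_inj]) (auto simp: clock_image)

lemma speed_clock: "v \<in> {0..1} \<Longrightarrow> t = clock v \<Longrightarrow> speed t = v"
  using clock_image by (auto simp: speed_def min_def intro!: the_inv_into_f_eq[OF clock_inj])

lemma speed_0: "speed 0 = 1"
  by (rule speed_clock) auto

lemma speed_after: "clock 0 \<le> t \<Longrightarrow> speed t = 0"
  using speed_clock[of 0 "clock 0"] by (simp add: speed_def)

lemma speed_before:
  assumes "0 < t" "t < clock 0"
  shows "speed t \<in> {0<..<1}"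
proof -
  have "clock (speed t) = t" using assms by (simp add: clock_speed)
  then have "speed t \<noteq> 0" "speed t \<noteq> 1" using assms by auto
  then show ?thesis using speed_in[of t] assms by auto
qed

lemma speed_cont: "continuous_on {0..} speed"
proof -
  have "continuous_on {0..clock 0} (the_inv_into {0..1} clock)"
    using continuous_on_inv_into[OF clock_cont _ clock_inj] by (simp add: clock_image)
  then show ?thesis
    unfolding speed_def
    by (rule continuous_on_compose2) (use clock_0_pos in \<open>auto intro!: continuous_intros\<close>)
qed

lemma has_real_derivative_speed:
  assumes "0 < t" "t < clock 0"
  shows "(speed has_real_derivative - (1 / slowness (speed t))) (at t)"
proof -
  have "(speed has_real_derivative inverse (- slowness (speed t))) (at t)"
  proof (rule DERIV_inverse_function[where f = clock and a = 0 and b = "clock 0"])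
    show "(clock has_real_derivative - slowness (speed t)) (at (speed t))"
      using speed_before[OF assms] by (rule has_real_derivative_clock)
    show "- slowness (speed t) \<noteq> 0" using slowness_bounds[of "speed t"] speed_in[of t] assms by simp
    show "clock (speed y) = y" if "0 < y" "y < clock 0" for y using that by (simp add: clock_speed)
    show "isCont speed t"
      using continuous_on_interior[OF speed_cont, of t] assms by simp
  qed (use assms in auto)
  then show ?thesis by (simp add: inverse_eq_divide)
qed

text \<open>In the chain rule the slowness in dX/dw cancels against its reciprocal in dw/dt; only
  the speed remains.\<close>

lemma has_real_derivative_position:
  assumes "0 < t" "t < clock 0"
  shows "(position has_real_derivative speed t) (at t)"
proof -
  have "slowness (speed t) \<noteq> 0" using slowness_bounds[of "speed t"] speed_in[of t] assms by simp
  then show ?thesis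
    unfolding position_def
    using DERIV_chain2[OF has_real_derivative_X[OF speed_before[OF assms]] has_real_derivative_speed[OF assms]]
    by simp
qed

lemma position_cont: "continuous_on {0..} position"
  unfolding position_def by (rule continuous_on_compose2[OF X_cont speed_cont speed_image]) simp

lemma slowness_speed_bounded:
  obtains M where "\<And>t. 0 \<le> t \<Longrightarrow> \<bar>1 / slowness (speed t)\<bar> \<le> M"
proof -
  have "continuous_on {0..1} (\<lambda>w. 1 / slowness w)"
    using slowness_bounds by (intro continuous_intros slowness_cont) force
  then have "bounded ((\<lambda>w. 1 / slowness w) ` {0..1})"
    by (intro compact_imp_bounded compact_continuous_image) auto
  then obtain M where "\<forall>w\<in>{0..1}. \<bar>1 / slowness w\<bar> \<le> M" by (auto simp: bounded_iff)
  then show thesis using that speed_in by blast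
qed

text \<open>Before \<open>clock 0\<close> the equation of motion is the definition of the slowness,
  solved for dw/dt. Afterwards everything is constant, and the friction has to balance the force.
  The junction is a single corner of the speed, harmless for membership in the Sobolev
  space.\<close>

lemma global_strong_solution: "global_strong_solution \<gamma> (\<lambda>v. r * \<bar>v\<bar>) F 0 1 position speed"
  unfolding global_strong_solution_def strong_solution_def
proof (intro allI impI conjI)
  fix T :: real assume T: "T > 0"
  let ?M = "lebesgue_on {0<..<T}" and ?T = "clock 0"
  show cx: "continuous_on {0..T} position" and cv: "continuous_on {0..T} speed"
    by (auto intro: continuous_on_subset[OF position_cont] continuous_on_subset[OF speed_cont])
  show "speed 0 = 1" by (rule speed_0)
  show "position 0 = 0" using X_eq[of 1] by (simp add: position_def speed_0)
  define dv where "dv = (\<lambda>t. if t < ?T then - (1 / slowness (speed t)) else 0)"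
  \<comment> \<open>At rest the inclusion reduces to \<xi> = - F. This value is admissible because
    \<open>F_nonneg\<close> and \<open>F_stick\<close> place F between 0 and \<open>r\<close> at the
    final position.\<close>
  define \<xi> where "\<xi> = (\<lambda>t. if t < ?T then r else - F (X 0) 0)"
  have pred: "{t \<in> space ?M. t < ?T} \<in> sets ?M"
    by (auto simp: sets_restrict_space intro!: image_eqI[of _ _ "{..<?T}"])
  have "W12_deriv 0 T position speed"
  proof (rule W12_deriv_piecewise[OF T _ cx, where S = "{?T}" and M = 1])
    show "speed \<in> borel_measurable ?M"
      by (intro continuous_imp_measurable_on_sets_lebesgue continuous_on_subset[OF speed_cont]) auto
    show "\<bar>speed t\<bar> \<le> 1" if "t \<in> {0<..<T}" for t using speed_in[of t] that by auto
    fix t assume t: "t \<in> {0<..<T} - {?T}"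
    show "(position has_real_derivative speed t) (at t)"
    proof (cases "t < ?T")
      case True
      then show ?thesis using t by (intro has_real_derivative_position) auto
    next
      case False
      then have "t > ?T" using t by auto
      have "((\<lambda>t. X 0) has_real_derivative speed t) (at t)"
        using \<open>t > ?T\<close> by (simp add: speed_after)
      then show ?thesis
        by (rule has_field_derivative_transform_within_open[where S = "{?T<..}"])
           (use \<open>t > ?T\<close> in \<open>auto simp: position_def speed_after\<close>)
    qed
  qed simp
  moreover have "W12_deriv 0 T speed dv"
  proof -
    obtain M where M: "\<And>t. 0 \<le> t \<Longrightarrow> \<bar>1 / slowness (speed t)\<bar> \<le> M" using slowness_speed_bounded by blast
    show ?thesis
    proof (rule W12_deriv_piecewise[OF T _ cv, where S = "{?T}" and M = M])
      have "continuous_on {0<..<T} (\<lambda>t. slowness (speed t))"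
        by (rule continuous_on_compose2[OF slowness_cont continuous_on_subset[OF speed_cont] speed_image]) auto
      moreover have "slowness (speed t) \<noteq> 0" if "t \<in> {0<..<T}" for t
        using slowness_bounds[of "speed t"] speed_in[of t] that by auto
      ultimately have "(\<lambda>t. - (1 / slowness (speed t))) \<in> borel_measurable ?M"
        by (intro continuous_imp_measurable_on_sets_lebesgue continuous_intros) auto
      then show "dv \<in> borel_measurable ?M"
        unfolding dv_def by (intro measurable_If pred) auto
      have "0 \<le> M" using M[of 0] by linarith
      then show "\<bar>dv t\<bar> \<le> M" if "t \<in> {0<..<T}" for t using M[of t] that by (auto simp: dv_def)
      fix t assume t: "t \<in> {0<..<T} - {?T}"
      show "(speed has_real_derivative dv t) (at t)"
      proof (cases "t < ?T")
        case True
        then show ?thesis using t has_real_derivative_speed[of t] by (auto simp: dv_def)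
      next
        case False
        then have "t > ?T" using t by auto
        have "((\<lambda>t. 0) has_real_derivative dv t) (at t)"
          using \<open>t > ?T\<close> by (simp add: dv_def)
        then show ?thesis
          by (rule has_field_derivative_transform_within_open[where S = "{?T<..}"])
             (use \<open>t > ?T\<close> in \<open>auto simp: speed_after\<close>)
      qed
    qed simp
  qed
  moreover have "square_integrable_on 0 T \<xi>"
  proof (rule bounded_square_integrable[where M = "max r \<bar>F (X 0) 0\<bar>"])
    show "\<xi> \<in> borel_measurable ?M" unfolding \<xi>_def by (intro measurable_If pred) auto
  qed (use r in \<open>auto simp: \<xi>_def\<close>)
  moreover have "AE t in ?M. speed t = speed t \<and> \<xi> t \<in> subdifferential (\<lambda>v. r * \<bar>v\<bar>) (speed t) \<and>
      dv t + \<gamma> * speed t + \<xi> t + F (position t) (speed t) = 0"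
  proof (rule AE_I2, intro conjI refl)
    fix t assume "t \<in> space ?M"
    then have t: "0 < t" by simp
    show "\<xi> t \<in> subdifferential (\<lambda>v. r * \<bar>v\<bar>) (speed t)"
    proof (cases "t < ?T")
      case True
      then show ?thesis using speed_before[OF t True] r by (simp add: \<xi>_def subdifferential_friction_pos)
    next
      case False
      have "0 \<le> F (X 0) 0" "F (X 0) 0 \<le> r"
        using F_nonneg[of "X 0" 0] F_stick[of "X 0"] X_nonneg[of 0] X_le[of 0] by auto
      then show ?thesis using False r by (simp add: \<xi>_def speed_after subdifferential_friction_zero)
    qed
    show "dv t + \<gamma> * speed t + \<xi> t + F (position t) (speed t) = 0"
    proof (cases "t < ?T")
      case True
      then show ?thesis by (simp add: dv_def \<xi>_def slowness_def position_def)
    next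
      case False
      then show ?thesis by (simp add: dv_def \<xi>_def speed_after position_def)
    qed
  qed
  ultimately show "\<exists>dx dv \<xi>. W12_deriv 0 T position dx \<and> W12_deriv 0 T speed dv \<and> square_integrable_on 0 T \<xi> \<and>
     (AE t in ?M. speed t = dx t \<and> \<xi> t \<in> subdifferential (\<lambda>v. r * \<bar>v\<bar>) (speed t) \<and>
        dv t + \<gamma> * speed t + \<xi> t + F (position t) (speed t) = 0)" by blast
qed

text \<open>Speed 0 at time \<open>T\<close> forces \<open>clock 0 = min T (clock 0)\<close> through
  \<open>clock_speed\<close>, so the admissible times are exactly the ray starting at
  \<open>clock 0\<close>.\<close>

lemma stopping_time_speed: "stopping_time speed = ereal (clock 0)"
proof -
  have "{ereal T |T. T \<ge> 0 \<and> (\<forall>t\<ge>T. speed t = 0)} = ereal ` {clock 0..}"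
  proof (intro equalityI subsetI)
    fix e assume "e \<in> {ereal T |T. T \<ge> 0 \<and> (\<forall>t\<ge>T. speed t = 0)}"
    then obtain T where T: "e = ereal T" "T \<ge> 0" "speed T = 0" by blast
    then have "clock 0 \<le> T" using clock_speed[of T] by simp
    then show "e \<in> ereal ` {clock 0..}" using T by simp
  next
    fix e assume "e \<in> ereal ` {clock 0..}"
    then show "e \<in> {ereal T |T. T \<ge> 0 \<and> (\<forall>t\<ge>T. speed t = 0)}"
      using clock_0_pos speed_after by force
  qed
  moreover have "Inf (ereal ` {clock 0..}) = ereal (clock 0)"
    by (intro antisym Inf_lower Inf_greatest) auto
  ultimately show ?thesis by (simp add: stopping_time_def)
qed

end

text \<open>The hypotheses speak of x \<ge> 0 only, whereas the fixed point is sought among all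
  continuous functions. The force is therefore frozen at x = 0 for negative x; the fixed point turns
  out nonnegative, so the modification is never felt.\<close>

lemma sliding_arc_exists:
  fixes F :: "real \<Rightarrow> real \<Rightarrow> real"
  assumes "\<gamma> > 0" "r > 0"
    and F_cont: "continuous_on ({0..} \<times> {0..1}) (\<lambda>(x, w). F x w)"
    and F_nonneg: "\<And>x w. 0 \<le> x \<Longrightarrow> w \<in> {0..1} \<Longrightarrow> 0 \<le> F x w"
    and F_stick: "\<And>x. 0 \<le> x \<Longrightarrow> x \<le> 1 / r \<Longrightarrow> F x 0 \<le> r"
    and contr: "\<And>x y w. 0 \<le> x \<Longrightarrow> 0 \<le> y \<Longrightarrow> w \<in> {0..1} \<Longrightarrow>
      \<bar>1 / (\<gamma> * w + r + F x w) - 1 / (\<gamma> * w + r + F y w)\<bar> \<le> \<bar>x - y\<bar> / 2"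
  shows "\<exists>X. sliding_arc \<gamma> r F X"
proof -
  define G where "G = (\<lambda>w x. \<gamma> * w + r + F (max 0 x) w)"
  have G: "r \<le> G w x" if "w \<in> {0..1}" for w x
    using that assms(1) F_nonneg[of "max 0 x" w] by (simp add: G_def)
  obtain X where X: "continuous_on {0..1} X"
    "\<And>v. v \<in> {0..1} \<Longrightarrow> X v = integral {v..1} (\<lambda>w. w * (1 / G w (X w)))"
  proof (rule backward_picard[of "\<lambda>w x. w * (1 / G w x)"])
    have "continuous_on ({0..1} \<times> UNIV) (\<lambda>z. F (max 0 (snd z)) (fst z))"
      by (rule continuous_on_compose2[OF F_cont, of _ "\<lambda>z. (max 0 (snd z), fst z)", simplified])
         (auto intro!: continuous_intros)
    moreover have "G (fst z) (snd z) \<noteq> 0" if "z \<in> {0..1} \<times> UNIV" for z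
      using G[of "fst z" "snd z"] that \<open>r > 0\<close> by (auto simp: mem_Times_iff)
    ultimately show "continuous_on ({0..1} \<times> UNIV) (\<lambda>(w, x). w * (1 / G w x))"
      unfolding case_prod_unfold G_def by (intro continuous_intros) auto
    fix w x y :: real assume w: "w \<in> {0..1}"
    have "\<bar>w * (1 / G w x) - w * (1 / G w y)\<bar> = w * \<bar>1 / G w x - 1 / G w y\<bar>"
      using w by (subst right_diff_distrib[symmetric]) (simp add: abs_mult)
    also have "\<dots> \<le> 1 * \<bar>1 / G w x - 1 / G w y\<bar>" using w by (intro mult_right_mono) auto
    also have "\<dots> \<le> \<bar>max 0 x - max 0 y\<bar> / 2" using contr[of "max 0 x" "max 0 y" w] w by (simp add: G_def)
    also have "\<dots> \<le> \<bar>x - y\<bar> / 2" by (auto simp: max_def)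
    finally show "\<bar>w * (1 / G w x) - w * (1 / G w y)\<bar> \<le> \<bar>x - y\<bar> / 2" .
  qed blast
  \<comment> \<open>The integrand is nonnegative because \<open>G\<close> is at least
    \<open>r\<close>. An integral that does not exist has the default value 0, so integrability need
    not be established here.\<close>
  have nonneg: "0 \<le> X v" if "v \<in> {0..1}" for v
    unfolding X(2)[OF that]
  proof (cases "(\<lambda>w. w * (1 / G w (X w))) integrable_on {v..1}")
    case True
    have "0 \<le> w * (1 / G w (X w))" if "w \<in> {v..1}" for w
      using G[of w "X w"] that \<open>v \<in> {0..1}\<close> \<open>r > 0\<close> by simp
    then show "0 \<le> integral {v..1} (\<lambda>w. w * (1 / G w (X w)))"
      by (rule Henstock_Kurzweil_Integration.integral_nonneg[OF True])
  qed (simp add: not_integrable_integral)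
  have "sliding_arc \<gamma> r F X"
  proof
    fix v :: real assume v: "v \<in> {0..1}"
    show "0 \<le> X v" using v by (rule nonneg)
    show "X v = integral {v..1} (\<lambda>w. w * (1 / (\<gamma> * w + r + F (X w) w)))"
      unfolding X(2)[OF v]
      by (rule Henstock_Kurzweil_Integration.integral_cong) (use v nonneg in \<open>auto simp: G_def\<close>)
  qed (use assms X in auto)
  then show ?thesis by blast
qed

section \<open>Comparing the two forces\<close>

lemma implicit_force_potential: "implicit_force potential \<beta> = (\<lambda>x v. slope (x + \<beta> * v))"
  by (simp add: implicit_force_def[abs_def] deriv_potential)

lemma explicit_force_potential: "explicit_force potential \<beta> = (\<lambda>x v. slope x + \<beta> * (2 - sin x) * v)"
  by (simp add: explicit_force_def[abs_def] deriv_potential deriv_slope)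

lemma slope_nonneg: "0 \<le> x \<Longrightarrow> 0 \<le> slope x"
  using cos_ge_minus_one[of x] by linarith

lemma slope_stick: "x \<le> 1 / 4 \<Longrightarrow> slope x \<le> 3"
  using cos_le_one[of x] by linarith

lemma sin_bounds: "1 \<le> 2 - sin x" "2 - sin x \<le> 3" for x :: real
  using sin_ge_minus_one[of x] sin_le_one[of x] by auto

lemma explicit_term_diff_le:
  "\<bar>(2 - sin x) * v - (2 - sin y) * w\<bar> \<le> 3 * \<bar>v - w\<bar> + \<bar>x - y\<bar> * \<bar>w\<bar>" for x y v w :: real
proof -
  have "(2 - sin x) * v - (2 - sin y) * w = (2 - sin x) * (v - w) + (sin y - sin x) * w"
    by (simp add: algebra_simps)
  also have "\<bar>\<dots>\<bar> \<le> \<bar>2 - sin x\<bar> * \<bar>v - w\<bar> + \<bar>sin y - sin x\<bar> * \<bar>w\<bar>"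
    using abs_triangle_ineq[of "(2 - sin x) * (v - w)" "(sin y - sin x) * w"] by (simp add: abs_mult)
  also have "\<dots> \<le> 3 * \<bar>v - w\<bar> + \<bar>x - y\<bar> * \<bar>w\<bar>"
    using sin_bounds[of x] sin_diff_le[of y x]
    by (intro add_mono mult_right_mono) (linarith, auto simp: abs_minus_commute)
  finally show ?thesis .
qed

lemma locally_lipschitz_implicit:
  assumes "\<beta> \<ge> 0"
  shows "locally_lipschitz (implicit_force potential \<beta>)"
  unfolding locally_lipschitz_def implicit_force_potential
proof (intro allI exI conjI impI)
  fix x y v w :: real
  have "\<bar>slope (x + \<beta> * v) - slope (y + \<beta> * w)\<bar> \<le> 3 * \<bar>(x - y) + \<beta> * (v - w)\<bar>"
    using slope_diff_le[of "x + \<beta> * v" "y + \<beta> * w"] by (simp add: algebra_simps)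
  also have "\<dots> \<le> 3 * (\<bar>x - y\<bar> + \<beta> * \<bar>v - w\<bar>)"
    using abs_triangle_ineq[of "x - y" "\<beta> * (v - w)"] assms by (simp add: abs_mult)
  also have "\<dots> \<le> 3 * (1 + \<beta>) * (\<bar>x - y\<bar> + \<bar>v - w\<bar>)"
    using assms by (simp add: algebra_simps)
  finally show "\<bar>slope (x + \<beta> * v) - slope (y + \<beta> * w)\<bar> \<le> 3 * (1 + \<beta>) * (\<bar>x - y\<bar> + \<bar>v - w\<bar>)" .
qed (use assms in simp)

lemma locally_lipschitz_explicit:
  assumes "\<beta> \<ge> 0"
  shows "locally_lipschitz (explicit_force potential \<beta>)"
  unfolding locally_lipschitz_def explicit_force_potential
proof (intro allI exI conjI impI)
  fix R x y v w :: real assume w: "\<bar>w\<bar> \<le> R"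
  let ?e = "\<bar>x - y\<bar> + \<bar>v - w\<bar>"
  have "\<bar>(2 - sin x) * v - (2 - sin y) * w\<bar> \<le> 3 * \<bar>v - w\<bar> + \<bar>x - y\<bar> * \<bar>w\<bar>"
    by (rule explicit_term_diff_le)
  also have "\<dots> \<le> 3 * \<bar>v - w\<bar> + \<bar>x - y\<bar> * \<bar>R\<bar>" using w by (intro add_mono mult_left_mono) auto
  also have "\<dots> \<le> (3 + \<bar>R\<bar>) * ?e" by (simp add: algebra_simps)
  finally have "\<beta> * \<bar>(2 - sin x) * v - (2 - sin y) * w\<bar> \<le> \<beta> * ((3 + \<bar>R\<bar>) * ?e)"
    using assms by (rule mult_left_mono)
  moreover have "\<beta> * \<bar>(2 - sin x) * v - (2 - sin y) * w\<bar> = \<bar>\<beta> * (2 - sin x) * v - \<beta> * (2 - sin y) * w\<bar>"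
    using assms by (simp add: abs_mult mult.assoc flip: right_diff_distrib)
  ultimately have "\<bar>\<beta> * (2 - sin x) * v - \<beta> * (2 - sin y) * w\<bar> \<le> \<beta> * ((3 + \<bar>R\<bar>) * ?e)" by simp
  moreover have "\<bar>slope x - slope y\<bar> \<le> 3 * ?e"
    by (rule order_trans[OF slope_diff_le]) simp
  moreover have "(3 + \<beta> * (3 + \<bar>R\<bar>)) * ?e = 3 * ?e + \<beta> * ((3 + \<bar>R\<bar>) * ?e)" by (simp add: algebra_simps)
  moreover have "slope x + \<beta> * (2 - sin x) * v - (slope y + \<beta> * (2 - sin y) * w)
      = (slope x - slope y) + (\<beta> * (2 - sin x) * v - \<beta> * (2 - sin y) * w)" by simp
  ultimately show "\<bar>slope x + \<beta> * (2 - sin x) * v - (slope y + \<beta> * (2 - sin y) * w)\<bar>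
      \<le> (3 + \<beta> * (3 + \<bar>R\<bar>)) * ?e"
    using abs_triangle_ineq[of "slope x - slope y" "\<beta> * (2 - sin x) * v - \<beta> * (2 - sin y) * w"]
    by (simp only:)
next
  show "0 \<le> 3 + \<beta> * (3 + \<bar>R\<bar>)" for R :: real using assms by simp
qed

section \<open>Contraction estimates for the two forces\<close>

lemma reciprocal_diff:
  fixes A B :: real
  assumes "A > 0" "B > 0"
  shows "1 / A - 1 / B = (B - A) * (1 / A) * (1 / B)"
  using assms by (simp add: field_simps)

text \<open>The factor 1/16 is the inverse square of the friction coefficient 4, the common lower
  bound of all decelerations.\<close>

lemma reciprocal_diff_le:
  fixes A B :: real
  assumes "A \<ge> 4" "B \<ge> 4"
  shows "\<bar>1 / A - 1 / B\<bar> \<le> \<bar>A - B\<bar> / 16"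
proof -
  have "\<bar>1 / A - 1 / B\<bar> = \<bar>A - B\<bar> / (A * B)"
    using assms by (simp add: reciprocal_diff abs_mult abs_minus_commute)
  also have "\<dots> \<le> \<bar>A - B\<bar> / 16"
    using mult_mono[of 4 A 4 B] assms by (intro divide_left_mono) auto
  finally show ?thesis .
qed

text \<open>The shift \<open>\<beta> * w\<close> is common to both arguments, so the force is
  3-Lipschitz in x whatever \<beta> is, and 3/16 is below 1/2.\<close>

lemma sliding_arc_implicit:
  assumes "\<gamma> > 0" "\<beta> \<ge> 0"
  shows "\<exists>X. sliding_arc \<gamma> 4 (implicit_force potential \<beta>) X"
  unfolding implicit_force_potential
proof (rule sliding_arc_exists)
  show "continuous_on ({0..} \<times> {0..1}) (\<lambda>(x, w). slope (x + \<beta> * w))"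
    unfolding case_prod_unfold by (intro continuous_intros)
  have nonneg: "0 \<le> slope (x + \<beta> * w)" if "0 \<le> x" "w \<in> {0..1}" for x w
    using that assms by (intro slope_nonneg) auto
  then show "0 \<le> slope (x + \<beta> * w)" if "0 \<le> x" "w \<in> {0..1}" for x w using that by blast
  show "slope (x + \<beta> * 0) \<le> 4" if "x \<le> 1 / 4" for x using slope_stick[OF that] by simp
  fix x y w :: real assume xy: "0 \<le> x" "0 \<le> y" and w: "w \<in> {0..1}"
  have "4 \<le> \<gamma> * w + 4 + slope (z + \<beta> * w)" if "0 \<le> z" for z
  proof -
    have "0 \<le> \<gamma> * w" using w assms by simp
    then show ?thesis using nonneg[OF that w] by linarith
  qed
  then have "\<bar>1 / (\<gamma> * w + 4 + slope (x + \<beta> * w)) - 1 / (\<gamma> * w + 4 + slope (y + \<beta> * w))\<bar>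
      \<le> \<bar>(\<gamma> * w + 4 + slope (x + \<beta> * w)) - (\<gamma> * w + 4 + slope (y + \<beta> * w))\<bar> / 16"
    using xy by (intro reciprocal_diff_le) blast+
  also have "\<dots> = \<bar>slope (x + \<beta> * w) - slope (y + \<beta> * w)\<bar> / 16"
    by (rule arg_cong[where f = "\<lambda>z. \<bar>z\<bar> / 16"]) simp
  also have "\<dots> \<le> \<bar>x - y\<bar> / 2" using slope_diff_le[of "x + \<beta> * w" "y + \<beta> * w"] by simp
  finally show "\<bar>1 / (\<gamma> * w + 4 + slope (x + \<beta> * w)) - 1 / (\<gamma> * w + 4 + slope (y + \<beta> * w))\<bar> \<le> \<bar>x - y\<bar> / 2" .
qed (use assms in auto)

text \<open>Here the Lipschitz constant of the force in x, \<open>3 + \<beta> * w\<close>, grows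
  with \<beta>. The same term \<open>\<beta> * w\<close> also enlarges the deceleration, since f''
  \<ge> 1, and the quotient stays bounded; this covers every \<beta> \<ge> 0.\<close>

lemma sliding_arc_explicit:
  assumes "\<gamma> > 0" "\<beta> \<ge> 0"
  shows "\<exists>X. sliding_arc \<gamma> 4 (explicit_force potential \<beta>) X"
  unfolding explicit_force_potential
proof (rule sliding_arc_exists)
  let ?F = "\<lambda>x w. slope x + \<beta> * (2 - sin x) * w"
  show "continuous_on ({0..} \<times> {0..1}) (\<lambda>(x, w). ?F x w)"
    unfolding case_prod_unfold by (intro continuous_intros)
  have ge: "\<beta> * w \<le> ?F x w" if "0 \<le> x" "w \<in> {0..1}" for x w
  proof -
    have "\<beta> * 1 * w \<le> \<beta> * (2 - sin x) * w"
      using that assms sin_bounds[of x] by (intro mult_right_mono mult_left_mono) auto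
    then show ?thesis using slope_nonneg[OF that(1)] by linarith
  qed
  show "0 \<le> ?F x w" if "0 \<le> x" "w \<in> {0..1}" for x w
    using ge[OF that] that assms by (meson atLeastAtMost_iff mult_nonneg_nonneg order_trans)
  show "?F x 0 \<le> 4" if "x \<le> 1 / 4" for x using slope_stick[OF that] by simp
  fix x y w :: real assume xy: "0 \<le> x" "0 \<le> y" and w: "w \<in> {0..1}"
  define A where "A = \<gamma> * w + 4 + ?F x w"
  define B where "B = \<gamma> * w + 4 + ?F y w"
  have \<beta>w: "0 \<le> \<beta> * w" "0 \<le> \<gamma> * w" using assms w by auto
  have A: "4 + \<beta> * w \<le> A" and B: "4 \<le> B"
    using ge[OF xy(1) w] ge[OF xy(2) w] \<beta>w by (auto simp: A_def B_def)
  have "\<beta> * \<bar>(2 - sin x) * w - (2 - sin y) * w\<bar> \<le> \<beta> * (\<bar>x - y\<bar> * w)"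
    using explicit_term_diff_le[of x w y w] assms w by (intro mult_left_mono) auto
  moreover have "\<beta> * \<bar>(2 - sin x) * w - (2 - sin y) * w\<bar> = \<bar>\<beta> * (2 - sin x) * w - \<beta> * (2 - sin y) * w\<bar>"
    using assms by (simp add: abs_mult mult.assoc flip: right_diff_distrib)
  moreover have "(3 + \<beta> * w) * \<bar>x - y\<bar> = 3 * \<bar>x - y\<bar> + \<beta> * (\<bar>x - y\<bar> * w)" by (simp add: algebra_simps)
  ultimately have AB: "\<bar>A - B\<bar> \<le> (3 + \<beta> * w) * \<bar>x - y\<bar>"
    using slope_diff_le[of x y] unfolding A_def B_def by linarith
  have "\<bar>1 / A - 1 / B\<bar> = \<bar>A - B\<bar> / (A * B)"
    using A B \<beta>w by (simp add: reciprocal_diff abs_mult abs_minus_commute)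
  also have "\<dots> \<le> (3 + \<beta> * w) * \<bar>x - y\<bar> / (A * B)"
    using AB A B \<beta>w by (intro divide_right_mono) auto
  \<comment> \<open>One denominator, at least \<open>4 + \<beta> * w\<close>, cancels the growing
    Lipschitz constant; of the other only the lower bound 2 is used.\<close>
  also have "\<dots> \<le> (3 + \<beta> * w) * \<bar>x - y\<bar> / ((3 + \<beta> * w) * 2)"
    using A B \<beta>w by (intro divide_left_mono mult_mono mult_nonneg_nonneg mult_pos_pos) auto
  also have "\<dots> = \<bar>x - y\<bar> / 2" using \<beta>w by (intro mult_divide_mult_cancel_left) simp
  finally show "\<bar>1 / (\<gamma> * w + 4 + ?F x w) - 1 / (\<gamma> * w + 4 + ?F y w)\<bar> \<le> \<bar>x - y\<bar> / 2"
    by (simp add: A_def B_def)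
qed (use assms in auto)

text \<open>Taylor expansion of the cosine with Lagrange remainder; the affine part of
  \<open>slope\<close> is exact. The remainder carries f''' = - cos and is the origin of the
  \<beta>^2 gap between the two forces.\<close>

lemma slope_second_order:
  assumes "0 \<le> h"
  obtains t where "0 \<le> t" "t \<le> h" "slope (y + h) = slope y + (2 - sin y) * h - cos (y + t) * h\<^sup>2 / 2"
proof (cases "h = 0")
  case True
  then show ?thesis by (intro that[of 0]) auto
next
  case False
  then have "h > 0" using assms by simp
  define diff where "diff = (\<lambda>m::nat. if m = 0 then (\<lambda>t. cos (y + t)) else if m = 1 then (\<lambda>t. - sin (y + t)) else (\<lambda>t. - cos (y + t)))"
  have "\<exists>t>0. t < h \<and> cos (y + h) = (\<Sum>m<2. diff m 0 / fact m * h ^ m) + diff 2 t / fact 2 * h ^ 2"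
  proof (rule Maclaurin[OF \<open>h > 0\<close>])
    show "\<forall>m t. m < 2 \<and> 0 \<le> t \<and> t \<le> h \<longrightarrow> (diff m has_real_derivative diff (Suc m) t) (at t)"
    proof (intro allI impI)
      fix m :: nat and t assume "m < 2 \<and> 0 \<le> t \<and> t \<le> h"
      then consider "m = 0" | "m = 1" by linarith
      then show "(diff m has_real_derivative diff (Suc m) t) (at t)"
        by cases (auto simp: diff_def intro!: derivative_eq_intros)
    qed
  qed (auto simp: diff_def)
  then obtain t where "0 < t" "t < h"
    "cos (y + h) = (\<Sum>m<2. diff m 0 / fact m * h ^ m) + diff 2 t / fact 2 * h ^ 2" by blast
  then show ?thesis
    by (intro that[of t]) (auto simp: diff_def numeral_2_eq_2 algebra_simps)
qed

lemma slope_mvt: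
  obtains \<eta> where "min x y \<le> \<eta>" "\<eta> \<le> max x y" "slope y - slope x = (2 - sin \<eta>) * (y - x)"
proof -
  have mvt: "\<exists>\<eta>. x < \<eta> \<and> \<eta> < y \<and> slope y - slope x = (y - x) * (2 - sin \<eta>)" if "x < y" for x y
    using MVT2[OF that has_real_derivative_slope] by blast
  consider "x < y" | "x = y" | "y < x" by linarith
  then show thesis
  proof cases
    case 1
    with mvt obtain \<eta> where "x < \<eta>" "\<eta> < y" "slope y - slope x = (y - x) * (2 - sin \<eta>)" by blast
    then show thesis by (intro that[of \<eta>]) auto
  next
    case 2
    then show thesis by (intro that[of x]) auto
  next
    case 3
    with mvt obtain \<eta> where "y < \<eta>" "\<eta> < x" "slope x - slope y = (x - y) * (2 - sin \<eta>)" by blast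
    then show thesis by (intro that[of \<eta>]) (auto simp: algebra_simps)
  qed
qed


section \<open>Estimates on the unit interval and linear rates in \<beta>\<close>

lemma abs_weighted_le: "w \<in> {0..1} \<Longrightarrow> \<bar>a\<bar> \<le> c \<Longrightarrow> \<bar>w * a\<bar> \<le> c" for w a c :: real
  using mult_mono[of w 1 "\<bar>a\<bar>" c] by (simp add: abs_mult)

lemma integral_close:
  fixes g h :: "real \<Rightarrow> real"
  assumes "continuous_on {0..1} g" "continuous_on {0..1} h" "v \<in> {0..1}"
    and "\<And>w. w \<in> {0..1} \<Longrightarrow> \<bar>g w - h w\<bar> \<le> c"
  shows "\<bar>integral {v..1} g - integral {v..1} h\<bar> \<le> c"
proof -
  have "integral {v..1} g - integral {v..1} h = integral {v..1} (\<lambda>w. g w - h w)"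
    using assms(1-3)
    by (intro Henstock_Kurzweil_Integration.integral_diff[symmetric] integrable_continuous_interval)
      (auto intro: continuous_on_subset)
  also have "\<bar>\<dots>\<bar> \<le> c"
  proof (rule integral_le_const)
    show "continuous_on {v..1} (\<lambda>w. g w - h w)"
      using assms(1-3) by (auto intro!: continuous_intros intro: continuous_on_subset)
    show "0 \<le> c" using assms(4)[OF assms(3)] by linarith
  qed (use assms(3,4) in auto)
  finally show ?thesis .
qed

lemma tendsto_at_right_rate:
  fixes g :: "real \<Rightarrow> real"
  assumes "\<forall>\<^sub>F \<beta> in at_right 0. \<bar>g \<beta> - c\<bar> \<le> C * \<beta>"
  shows "(g \<longlongrightarrow> c) (at_right 0)"
proof -
  have "((\<lambda>\<beta>. C * \<beta>) \<longlongrightarrow> 0) (at_right 0)"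
    using tendsto_mult_right_zero[OF tendsto_ident_at] .
  with assms have "((\<lambda>\<beta>. g \<beta> - c) \<longlongrightarrow> 0) (at_right 0)"
    unfolding real_norm_def[symmetric] by (rule Lim_null_comparison)
  then show ?thesis by (simp add: LIM_zero_iff)
qed

lemma eventually_small: "\<forall>\<^sub>F \<beta>::real in at_right 0. 0 < \<beta> \<and> \<beta> \<le> 1"
  unfolding eventually_at_right_field by (intro exI[of _ 1]) auto

text \<open>One arc is selected for each \<beta> and each scheme. As the forces coincide at \<beta>
  = 0, the implicit arc \<open>XI 0\<close> serves as reference for both families.\<close>

locale two_schemes =
  fixes \<gamma> :: real and XI XE :: "real \<Rightarrow> real \<Rightarrow> real"
  assumes arcI: "\<And>\<beta>. \<beta> \<ge> 0 \<Longrightarrow> sliding_arc \<gamma> 4 (implicit_force potential \<beta>) (XI \<beta>)"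
    and arcE: "\<And>\<beta>. \<beta> \<ge> 0 \<Longrightarrow> sliding_arc \<gamma> 4 (explicit_force potential \<beta>) (XE \<beta>)"
begin

abbreviation "pI \<beta> \<equiv> sliding_arc.slowness \<gamma> 4 (implicit_force potential \<beta>) (XI \<beta>)"
abbreviation "pE \<beta> \<equiv> sliding_arc.slowness \<gamma> 4 (explicit_force potential \<beta>) (XE \<beta>)"
abbreviation "X0 \<equiv> XI 0"
abbreviation "p0 \<equiv> pI 0"

lemma pI_eq: "\<beta> \<ge> 0 \<Longrightarrow> pI \<beta> w = 1 / (\<gamma> * w + 4 + slope (XI \<beta> w + \<beta> * w))"
  using arcI[of \<beta>] by (simp add: sliding_arc.slowness_def implicit_force_potential)

lemma pE_eq: "\<beta> \<ge> 0 \<Longrightarrow> pE \<beta> w = 1 / (\<gamma> * w + 4 + (slope (XE \<beta> w) + \<beta> * (2 - sin (XE \<beta> w)) * w))"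
  using arcE[of \<beta>] by (simp add: sliding_arc.slowness_def explicit_force_potential)

lemma decelerationI: "\<beta> \<ge> 0 \<Longrightarrow> w \<in> {0..1} \<Longrightarrow> 4 \<le> \<gamma> * w + 4 + slope (XI \<beta> w + \<beta> * w)"
  using sliding_arc.deceleration_ge[OF arcI, of \<beta> w] by (simp add: implicit_force_potential)

lemma decelerationE: "\<beta> \<ge> 0 \<Longrightarrow> w \<in> {0..1} \<Longrightarrow> 4 \<le> \<gamma> * w + 4 + (slope (XE \<beta> w) + \<beta> * (2 - sin (XE \<beta> w)) * w)"
  using sliding_arc.deceleration_ge[OF arcE, of \<beta> w] by (simp add: explicit_force_potential)

lemma p_bounds:
  assumes "\<beta> \<ge> 0" "w \<in> {0..1}"
  shows "0 < pI \<beta> w" "pI \<beta> w \<le> 1 / 4" "0 < pE \<beta> w" "pE \<beta> w \<le> 1 / 4"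
  using sliding_arc.slowness_bounds[OF arcI] sliding_arc.slowness_bounds[OF arcE] assms by blast+

text \<open>Either force differs from the undamped one on the reference arc by at most three times
  the position gap plus 3 \<beta>: in the implicit case because f' is 3-Lipschitz, in the explicit
  case because f'' and w are bounded by 3 and 1.\<close>

lemma p0_close_step:
  assumes "\<beta> \<ge> 0" "w \<in> {0..1}"
  shows "\<bar>pI \<beta> w - p0 w\<bar> \<le> 3 * (\<bar>XI \<beta> w - X0 w\<bar> + \<beta>) / 16"
    and "\<bar>pE \<beta> w - p0 w\<bar> \<le> 3 * (\<bar>XE \<beta> w - X0 w\<bar> + \<beta>) / 16"
proof -
  have \<beta>w: "0 \<le> \<beta> * w" "\<beta> * w \<le> \<beta>" using assms by (auto simp: mult_left_le)
  note d0 = decelerationI[OF order_refl assms(2), unfolded mult_zero_left add_0_right]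
  have "\<bar>slope (XI \<beta> w + \<beta> * w) - slope (X0 w)\<bar> \<le> 3 * \<bar>XI \<beta> w + \<beta> * w - X0 w\<bar>"
    by (rule slope_diff_le)
  also have "\<dots> \<le> 3 * (\<bar>XI \<beta> w - X0 w\<bar> + \<beta>)"
    using \<beta>w abs_triangle_ineq[of "XI \<beta> w - X0 w" "\<beta> * w"] by (simp add: algebra_simps)
  finally have "\<bar>(\<gamma> * w + 4 + slope (XI \<beta> w + \<beta> * w)) - (\<gamma> * w + 4 + slope (X0 w))\<bar>
      \<le> 3 * (\<bar>XI \<beta> w - X0 w\<bar> + \<beta>)" by linarith
  then show "\<bar>pI \<beta> w - p0 w\<bar> \<le> 3 * (\<bar>XI \<beta> w - X0 w\<bar> + \<beta>) / 16"
    using reciprocal_diff_le[OF decelerationI[OF assms] d0] assms by (simp add: pI_eq)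
  have "\<bar>slope (XE \<beta> w) - slope (X0 w)\<bar> \<le> 3 * \<bar>XE \<beta> w - X0 w\<bar>"
    by (rule slope_diff_le)
  moreover have s: "0 \<le> 2 - sin (XE \<beta> w)" "2 - sin (XE \<beta> w) \<le> 3"
    using sin_bounds[of "XE \<beta> w"] by linarith+
  moreover have w: "0 \<le> w" "w \<le> 1" using assms(2) by auto
  moreover have "0 \<le> \<beta> * (2 - sin (XE \<beta> w)) * w" by (intro mult_nonneg_nonneg assms(1) s w)
  moreover have "\<beta> * (2 - sin (XE \<beta> w)) * w \<le> \<beta> * 3 * 1"
    by (intro mult_mono mult_nonneg_nonneg assms(1) s w order_refl) simp
  moreover have "\<bar>a + t\<bar> \<le> b + c" if "\<bar>a\<bar> \<le> b" "0 \<le> t" "t \<le> c" for a b c t :: real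
    using that by linarith
  ultimately have "\<bar>(slope (XE \<beta> w) - slope (X0 w)) + \<beta> * (2 - sin (XE \<beta> w)) * w\<bar>
      \<le> 3 * \<bar>XE \<beta> w - X0 w\<bar> + \<beta> * 3 * 1" by blast
  then have "\<bar>(\<gamma> * w + 4 + (slope (XE \<beta> w) + \<beta> * (2 - sin (XE \<beta> w)) * w)) - (\<gamma> * w + 4 + slope (X0 w))\<bar>
      \<le> 3 * (\<bar>XE \<beta> w - X0 w\<bar> + \<beta>)" by (simp add: algebra_simps)
  then show "\<bar>pE \<beta> w - p0 w\<bar> \<le> 3 * (\<bar>XE \<beta> w - X0 w\<bar> + \<beta>) / 16"
    using reciprocal_diff_le[OF decelerationE[OF assms] d0] assms by (simp add: pI_eq pE_eq)
qed

lemma p_cont: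
  assumes "\<beta> \<ge> 0"
  shows "continuous_on {0..1} (pI \<beta>)" "continuous_on {0..1} (pE \<beta>)"
  using sliding_arc.slowness_cont[OF arcI] sliding_arc.slowness_cont[OF arcE] assms by blast+

lemma X_eqs:
  assumes "\<beta> \<ge> 0" "v \<in> {0..1}"
  shows "XI \<beta> v = integral {v..1} (\<lambda>w. w * pI \<beta> w)" "XE \<beta> v = integral {v..1} (\<lambda>w. w * pE \<beta> w)"
  using sliding_arc.X_eq'[OF arcI] sliding_arc.X_eq'[OF arcE] assms by blast+

text \<open>Stability with \<epsilon> = \<beta> gives the position bound 2 \<beta>. Inserted into
  the previous estimate it yields 9/16 \<beta> for the slownesses, rounded up to \<beta>.\<close>

lemma arcs_close:
  assumes "\<beta> \<ge> 0" "w \<in> {0..1}"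
  shows "\<bar>XI \<beta> w - X0 w\<bar> \<le> 2 * \<beta>" "\<bar>XE \<beta> w - X0 w\<bar> \<le> 2 * \<beta>"
    and "\<bar>pI \<beta> w - p0 w\<bar> \<le> \<beta>" "\<bar>pE \<beta> w - p0 w\<bar> \<le> \<beta>"
proof -
  have cont: "continuous_on {0..1} (\<lambda>w. w * pI \<beta> w)" "continuous_on {0..1} (\<lambda>w. w * pE \<beta> w)"
    "continuous_on {0..1} (\<lambda>w. w * p0 w)"
    using assms by (auto intro!: continuous_intros p_cont)
  have *: "\<bar>w * pI \<beta> w - w * p0 w\<bar> \<le> \<bar>XI \<beta> w - X0 w\<bar> / 2 + \<beta>"
    "\<bar>w * pE \<beta> w - w * p0 w\<bar> \<le> \<bar>XE \<beta> w - X0 w\<bar> / 2 + \<beta>" if "w \<in> {0..1}" for w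
  proof -
    have le: "3 * (a + \<beta>) / 16 \<le> a / 2 + \<beta>" if "0 \<le> a" for a
      using that assms(1) by simp
    show "\<bar>w * pI \<beta> w - w * p0 w\<bar> \<le> \<bar>XI \<beta> w - X0 w\<bar> / 2 + \<beta>"
      "\<bar>w * pE \<beta> w - w * p0 w\<bar> \<le> \<bar>XE \<beta> w - X0 w\<bar> / 2 + \<beta>"
      unfolding right_diff_distrib[symmetric]
      by (rule abs_weighted_le[OF that] order_trans[OF p0_close_step(1)[OF assms(1) that]]
          order_trans[OF p0_close_step(2)[OF assms(1) that]] le abs_ge_zero)+
  qed
  show I: "\<bar>XI \<beta> w - X0 w\<bar> \<le> 2 * \<beta>"
    by (rule backward_integral_close[OF cont(1,3) _ _ *(1) assms(2)]) (use X_eqs assms in auto)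
  show E: "\<bar>XE \<beta> w - X0 w\<bar> \<le> 2 * \<beta>"
    by (rule backward_integral_close[OF cont(2,3) _ _ *(2) assms(2)]) (use X_eqs assms in auto)
  show "\<bar>pI \<beta> w - p0 w\<bar> \<le> \<beta>" "\<bar>pE \<beta> w - p0 w\<bar> \<le> \<beta>"
    using p0_close_step[OF assms] I E assms(1) by - argo+
qed

text \<open>The linearisation at \<open>\<beta> = 0\<close>: if \<open>x\<close> is the rescaled difference of the positions at speed
  \<open>w\<close>, the rescaled difference of the slownesses is \<open>q w x\<close>. The inhomogeneity comes from
  \<open>f'(x) + \<beta> f''(x) w - f'(x + \<beta> w) \<approx> - \<beta>\<^sup>2 w\<^sup>2 f'''(x) / 2\<close>.\<close>

definition q :: "real \<Rightarrow> real \<Rightarrow> real" where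
  "q w x = (w\<^sup>2 / 2 * cos (X0 w) - (2 - sin (X0 w)) * x) * (p0 w)\<^sup>2"

section \<open>The rescaled gap between the schemes and its limit\<close>

definition Q :: "real \<Rightarrow> real \<Rightarrow> real" where
  "Q \<beta> w = (pI \<beta> w - pE \<beta> w) / \<beta>\<^sup>2"

definition U :: "real \<Rightarrow> real \<Rightarrow> real" where
  "U \<beta> w = (XI \<beta> w - XE \<beta> w) / \<beta>\<^sup>2"

lemma Q_cont: "\<beta> \<ge> 0 \<Longrightarrow> continuous_on {0..1} (Q \<beta>)"
  \<comment> \<open>For \<beta> = 0 the quotient has the default value 0, so \<open>Q 0\<close> is
    constant.\<close>
  unfolding Q_def[abs_def] by (cases "\<beta> = 0") (auto intro!: continuous_intros p_cont)

text \<open>The second part makes the rescaled position gap \<open>U\<close> a backward integral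
  driven by \<open>Q\<close>. Since \<open>Q\<close> in turn depends on \<open>U\<close>, this
  closes an equation of the type covered by the stability estimate.\<close>

lemma integral_Q:
  assumes "\<beta> \<ge> 0" "v \<in> {0..1}"
  shows "integral {v..1} (Q \<beta>) = (integral {v..1} (pI \<beta>) - integral {v..1} (pE \<beta>)) / \<beta>\<^sup>2"
    and "U \<beta> v = integral {v..1} (\<lambda>w. w * Q \<beta> w)"
proof -
  have int: "(\<lambda>w. w * pI \<beta> w) integrable_on {v..1}" "(\<lambda>w. w * pE \<beta> w) integrable_on {v..1}"
    "pI \<beta> integrable_on {v..1}" "pE \<beta> integrable_on {v..1}"
    using assms
    by (auto intro!: integrable_continuous_interval continuous_intros
        continuous_on_subset[OF p_cont(1)] continuous_on_subset[OF p_cont(2)])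
  show "integral {v..1} (Q \<beta>) = (integral {v..1} (pI \<beta>) - integral {v..1} (pE \<beta>)) / \<beta>\<^sup>2"
    unfolding Q_def using Henstock_Kurzweil_Integration.integral_diff[OF int(3,4)] by simp
  have "integral {v..1} (\<lambda>w. w * Q \<beta> w) = integral {v..1} (\<lambda>w. (w * pI \<beta> w - w * pE \<beta> w) / \<beta>\<^sup>2)"
    by (rule Henstock_Kurzweil_Integration.integral_cong) (simp add: Q_def right_diff_distrib)
  also have "\<dots> = U \<beta> v"
    using Henstock_Kurzweil_Integration.integral_diff[OF int(1,2)] assms by (simp add: U_def X_eqs)
  finally show "U \<beta> v = integral {v..1} (\<lambda>w. w * Q \<beta> w)" ..
qed

text \<open>An exact identity for positive \<beta> that already has the shape of \<open>q\<close>.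
  Here \<open>c\<close> is a cosine at a Taylor point and \<open>a\<close> is f'' at a mean value
  point; both points lie within 3 \<beta> of the reference arc, 2 \<beta> from the arcs and \<beta>
  from the shift.\<close>

lemma Q_expansion:
  assumes \<beta>: "0 < \<beta>" "\<beta> \<le> 1" and w: "w \<in> {0..1}"
  obtains c a where "Q \<beta> w = (w\<^sup>2 / 2 * c - a * U \<beta> w) * (pI \<beta> w * pE \<beta> w)"
    "\<bar>c\<bar> \<le> 1" "\<bar>c - cos (X0 w)\<bar> \<le> 3 * \<beta>" "\<bar>a\<bar> \<le> 3" "\<bar>a - (2 - sin (X0 w))\<bar> \<le> 3 * \<beta>"
proof -
  define x where "x = XI \<beta> w"
  define y where "y = XE \<beta> w"
  have h: "0 \<le> \<beta> * w" "\<beta> * w \<le> \<beta>" using \<beta> w by (auto simp: mult_left_le)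
  have xy: "\<bar>x - X0 w\<bar> \<le> 2 * \<beta>" "\<bar>y - X0 w\<bar> \<le> 2 * \<beta>"
    using arcs_close[of \<beta> w] \<beta> w by (auto simp: x_def y_def)
  obtain t where t: "0 \<le> t" "t \<le> \<beta> * w"
    "slope (y + \<beta> * w) = slope y + (2 - sin y) * (\<beta> * w) - cos (y + t) * (\<beta> * w)\<^sup>2 / 2"
    using slope_second_order[OF h(1)] by blast
  obtain \<eta> where \<eta>: "min (x + \<beta> * w) (y + \<beta> * w) \<le> \<eta>" "\<eta> \<le> max (x + \<beta> * w) (y + \<beta> * w)"
    "slope (y + \<beta> * w) - slope (x + \<beta> * w) = (2 - sin \<eta>) * ((y + \<beta> * w) - (x + \<beta> * w))"
    using slope_mvt by blast
  define A where "A = \<gamma> * w + 4 + slope (x + \<beta> * w)"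
  define B where "B = \<gamma> * w + 4 + (slope y + \<beta> * (2 - sin y) * w)"
  have AB: "4 \<le> A" "4 \<le> B"
    using decelerationI[of \<beta> w] decelerationE[of \<beta> w] \<beta> w by (auto simp: A_def B_def x_def y_def)
  have p: "pI \<beta> w = 1 / A" "pE \<beta> w = 1 / B"
    using \<beta> by (auto simp: pI_eq pE_eq A_def B_def x_def y_def)
  have u: "x - y = \<beta>\<^sup>2 * U \<beta> w" using \<beta> by (simp add: U_def x_def y_def)
  \<comment> \<open>The intermediate term is the implicit force at the explicit position
    \<open>y\<close>. It separates the difference of the two forces at one position from the effect
    of the different positions.\<close>
  have "B - A = cos (y + t) * (\<beta> * w)\<^sup>2 / 2 + (slope (y + \<beta> * w) - slope (x + \<beta> * w))"
    using t(3) unfolding A_def B_def by (simp add: algebra_simps)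
  also have "\<dots> = cos (y + t) * (\<beta> * w)\<^sup>2 / 2 - (2 - sin \<eta>) * (x - y)"
    unfolding \<eta>(3) by (simp add: algebra_simps)
  also have "\<dots> = \<beta>\<^sup>2 * (w\<^sup>2 / 2 * cos (y + t) - (2 - sin \<eta>) * U \<beta> w)"
    unfolding u by (simp add: power_mult_distrib algebra_simps)
  finally have BA: "B - A = \<beta>\<^sup>2 * (w\<^sup>2 / 2 * cos (y + t) - (2 - sin \<eta>) * U \<beta> w)" .
  have "Q \<beta> w = (B - A) * (1 / A) * (1 / B) / \<beta>\<^sup>2"
    unfolding Q_def p using AB by (subst reciprocal_diff) auto
  also have "\<dots> = (w\<^sup>2 / 2 * cos (y + t) - (2 - sin \<eta>) * U \<beta> w) * (pI \<beta> w * pE \<beta> w)"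
    unfolding BA p using \<beta> by simp
  finally have eq: "Q \<beta> w = (w\<^sup>2 / 2 * cos (y + t) - (2 - sin \<eta>) * U \<beta> w) * (pI \<beta> w * pE \<beta> w)" .
  have "\<bar>y + t - X0 w\<bar> \<le> 3 * \<beta>" using xy t h by linarith
  then have c: "\<bar>cos (y + t) - cos (X0 w)\<bar> \<le> 3 * \<beta>" using cos_diff_le order_trans by blast
  have "\<bar>\<eta> - X0 w\<bar> \<le> 3 * \<beta>" using xy \<eta>(1,2) h by linarith
  then have "\<bar>sin \<eta> - sin (X0 w)\<bar> \<le> 3 * \<beta>" using sin_diff_le order_trans by blast
  then have a: "\<bar>(2 - sin \<eta>) - (2 - sin (X0 w))\<bar> \<le> 3 * \<beta>" by linarith
  have "\<bar>2 - sin \<eta>\<bar> \<le> 3" using sin_bounds[of \<eta>] by linarith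
  with eq c a show thesis by (intro that[of "cos (y + t)" "2 - sin \<eta>"]) auto
qed

text \<open>An a priori bound: the expansion gives |Q| \<le> 1/32 + 3/16 |U|, and stability against
  the zero function absorbs the second term. Without it the errors of the coefficients of
  \<open>U\<close> would not be known to be of order \<beta>.\<close>

lemma U_bound:
  assumes \<beta>: "0 < \<beta>" "\<beta> \<le> 1" and w: "w \<in> {0..1}"
  shows "\<bar>U \<beta> w\<bar> \<le> 1 / 16"
proof -
  have "\<bar>w * Q \<beta> w - 0\<bar> \<le> \<bar>U \<beta> w - 0\<bar> / 2 + 1 / 32" if w: "w \<in> {0..1}" for w
  proof -
    obtain c a where Q: "Q \<beta> w = (w\<^sup>2 / 2 * c - a * U \<beta> w) * (pI \<beta> w * pE \<beta> w)"
      and ca: "\<bar>c\<bar> \<le> 1" "\<bar>a\<bar> \<le> 3" using Q_expansion[OF \<beta> w] by metis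
    have "\<bar>w\<^sup>2 * c\<bar> \<le> 1" using ca(1) w by (auto simp: abs_mult intro!: mult_le_one power_le_one)
    moreover have "\<bar>a * U \<beta> w\<bar> \<le> 3 * \<bar>U \<beta> w\<bar>" using ca(2) by (simp add: abs_mult mult_right_mono)
    ultimately have k: "\<bar>w\<^sup>2 / 2 * c - a * U \<beta> w\<bar> \<le> 1 / 2 + 3 * \<bar>U \<beta> w\<bar>" by (simp add: abs_le_iff)
    have "\<bar>pI \<beta> w * pE \<beta> w\<bar> \<le> 1 / 4 * (1 / 4)"
      unfolding abs_mult using p_bounds[of \<beta> w] \<beta> w by (intro mult_mono) auto
    with k have "\<bar>Q \<beta> w\<bar> \<le> (1 / 2 + 3 * \<bar>U \<beta> w\<bar>) * (1 / 4 * (1 / 4))"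
      unfolding Q abs_mult[of "_ - _"] by (intro mult_mono) auto
    then have "\<bar>w * Q \<beta> w\<bar> \<le> (1 / 2 + 3 * \<bar>U \<beta> w\<bar>) * (1 / 4 * (1 / 4))"
      by (rule abs_weighted_le[OF w])
    then show ?thesis by simp
  qed
  then have "\<bar>U \<beta> w - 0\<bar> \<le> 2 * (1 / 32)"
    by (rule backward_integral_close[where a = "\<lambda>w. w * Q \<beta> w" and b = "\<lambda>_. 0", rotated 4])
       (use \<beta> w in \<open>auto intro!: continuous_intros Q_cont integral_Q(2)\<close>)
  then show ?thesis by simp
qed

text \<open>The coefficients and the two slownesses are replaced by their values on the reference
  arc. The slownesses cost at most \<beta>, the bracket at most 5 \<beta> times 1/16.\<close>

lemma Q_close_q:
  assumes \<beta>: "0 < \<beta>" "\<beta> \<le> 1" and w: "w \<in> {0..1}"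
  shows "\<bar>Q \<beta> w - q w (U \<beta> w)\<bar> \<le> 2 * \<beta>"
proof -
  obtain c a where Q: "Q \<beta> w = (w\<^sup>2 / 2 * c - a * U \<beta> w) * (pI \<beta> w * pE \<beta> w)"
    and ca: "\<bar>c\<bar> \<le> 1" "\<bar>c - cos (X0 w)\<bar> \<le> 3 * \<beta>" "\<bar>a\<bar> \<le> 3" "\<bar>a - (2 - sin (X0 w))\<bar> \<le> 3 * \<beta>"
    using Q_expansion[OF \<beta> w] by metis
  have U: "\<bar>U \<beta> w\<bar> \<le> 1" using U_bound[OF \<beta> w] by linarith
  have w2: "0 \<le> w\<^sup>2" "w\<^sup>2 \<le> 1" using w by (auto intro: power_le_one)
  define k where "k = w\<^sup>2 / 2 * c - a * U \<beta> w"
  define k0 where "k0 = w\<^sup>2 / 2 * cos (X0 w) - (2 - sin (X0 w)) * U \<beta> w"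
  have "\<bar>w\<^sup>2 * c\<bar> \<le> 1 * 1" unfolding abs_mult using ca w2 by (intro mult_mono) auto
  moreover have "\<bar>a * U \<beta> w\<bar> \<le> 3 * (1 / 16)"
    unfolding abs_mult using ca U_bound[OF \<beta> w] by (intro mult_mono) auto
  ultimately have k: "\<bar>k\<bar> \<le> 1" unfolding k_def by (simp add: abs_le_iff) linarith
  have "\<bar>w\<^sup>2 * (c - cos (X0 w))\<bar> \<le> 1 * (3 * \<beta>)" unfolding abs_mult using ca w2 by (intro mult_mono) auto
  moreover have "\<bar>(a - (2 - sin (X0 w))) * U \<beta> w\<bar> \<le> 3 * \<beta> * 1"
    unfolding abs_mult using ca U \<beta> by (intro mult_mono) auto
  moreover have "k - k0 = w\<^sup>2 * (c - cos (X0 w)) / 2 - (a - (2 - sin (X0 w))) * U \<beta> w"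
    unfolding k_def k0_def by (simp add: field_simps)
  ultimately have kk: "\<bar>k - k0\<bar> \<le> 5 * \<beta>" using \<beta> by (simp add: abs_le_iff)
  have "p0 w \<le> 1 / 4" "0 < p0 w" "pI \<beta> w \<le> 1 / 4" "0 < pI \<beta> w" using p_bounds[of 0 w] p_bounds[of \<beta> w] \<beta> w by auto
  then have P0: "\<bar>(p0 w)\<^sup>2\<bar> \<le> 1 / 4 * (1 / 4)"
    unfolding power2_eq_square abs_mult by (intro mult_mono) auto
  have pE: "\<bar>pE \<beta> w - p0 w\<bar> \<le> \<beta>" and pI: "\<bar>pI \<beta> w - p0 w\<bar> \<le> \<beta>"
    using arcs_close[of \<beta> w] \<beta> w by auto
  have "\<bar>pI \<beta> w * (pE \<beta> w - p0 w)\<bar> \<le> 1 / 4 * \<beta>" "\<bar>p0 w * (pI \<beta> w - p0 w)\<bar> \<le> 1 / 4 * \<beta>"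
    unfolding abs_mult using pE pI \<open>p0 w \<le> 1 / 4\<close> \<open>0 < p0 w\<close> \<open>pI \<beta> w \<le> 1 / 4\<close> \<open>0 < pI \<beta> w\<close>
    by (intro mult_mono; simp)+
  moreover have "pI \<beta> w * pE \<beta> w - (p0 w)\<^sup>2 = pI \<beta> w * (pE \<beta> w - p0 w) + p0 w * (pI \<beta> w - p0 w)"
    by (simp add: power2_eq_square algebra_simps)
  ultimately have PP: "\<bar>pI \<beta> w * pE \<beta> w - (p0 w)\<^sup>2\<bar> \<le> \<beta>" using \<beta> by linarith
  have "\<bar>k * (pI \<beta> w * pE \<beta> w - (p0 w)\<^sup>2)\<bar> \<le> 1 * \<beta>"
    unfolding abs_mult[of k] using k PP by (intro mult_mono) auto
  moreover have "\<bar>(k - k0) * (p0 w)\<^sup>2\<bar> \<le> 5 * \<beta> * (1 / 4 * (1 / 4))"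
    unfolding abs_mult[of "k - k0"] using kk P0 by (intro mult_mono) auto
  moreover have "Q \<beta> w - q w (U \<beta> w) = k * (pI \<beta> w * pE \<beta> w - (p0 w)\<^sup>2) + (k - k0) * (p0 w)\<^sup>2"
    unfolding Q q_def k_def[symmetric] k0_def[symmetric] by (simp add: algebra_simps)
  ultimately show ?thesis using \<beta> by linarith
qed

lemma q_lipschitz:
  assumes "w \<in> {0..1}"
  shows "\<bar>q w x - q w y\<bar> \<le> 3 / 16 * \<bar>x - y\<bar>"
proof -
  have "p0 w \<le> 1 / 4" "0 < p0 w" using p_bounds[of 0 w] assms by auto
  then have P0: "\<bar>(p0 w)\<^sup>2\<bar> \<le> 1 / 4 * (1 / 4)"
    unfolding power2_eq_square abs_mult by (intro mult_mono) auto
  have "\<bar>(2 - sin (X0 w)) * (y - x)\<bar> \<le> 3 * \<bar>x - y\<bar>"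
    unfolding abs_mult using sin_bounds[of "X0 w"] by (intro mult_mono) (linarith, auto)
  then have "\<bar>(2 - sin (X0 w)) * (y - x) * (p0 w)\<^sup>2\<bar> \<le> 3 * \<bar>x - y\<bar> * (1 / 4 * (1 / 4))"
    unfolding abs_mult[of _ "(p0 w)\<^sup>2"] using P0 by (intro mult_mono) auto
  moreover have "q w x - q w y = (2 - sin (X0 w)) * (y - x) * (p0 w)\<^sup>2"
    by (simp add: q_def algebra_simps)
  ultimately show ?thesis by simp
qed

lemma q_cont: "continuous_on {0..1} u \<Longrightarrow> continuous_on {0..1} (\<lambda>w. q w (u w))"
  unfolding q_def using p_cont(1)[of 0] sliding_arc.X_cont[OF arcI[of 0]]
  by (auto intro!: continuous_intros)

text \<open>The reference path stays in \<open>{0..1/4}\<close>, and 1/4 is below pi/3. This is the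
  quantitative form of the sign of f''' along the trajectory.\<close>

lemma cos_X0_ge: "w \<in> {0..1} \<Longrightarrow> 1 / 2 \<le> cos (X0 w)"
proof -
  assume w: "w \<in> {0..1}"
  have "0 \<le> X0 w" "X0 w \<le> 1 / 4"
    using sliding_arc.X_nonneg[OF arcI w] sliding_arc.X_le[OF arcI w] by auto
  moreover have "1 / 4 \<le> pi / 3" using pi_gt3 by simp
  ultimately have "cos (pi / 3) \<le> cos (X0 w)" by (intro cos_monotone_0_pi_le) auto
  then show ?thesis by (simp add: cos_60)
qed

text \<open>With \<open>K\<close> the integral of the source weight \<open>s\<close>, the source
  contributes at least K/2. The feedback is at most 3/16 |u|, and |u| \<le> 2 K, so it takes away at
  most 3/8 K.\<close>

lemma q_positive:
  assumes contu: "continuous_on {0..1} u" and u: "\<And>v. v \<in> {0..1} \<Longrightarrow> u v = integral {v..1} (\<lambda>w. w * q w (u w))"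
  shows "integral {0..1} (\<lambda>w. q w (u w)) > 0"
proof -
  define s where "s = (\<lambda>w. w\<^sup>2 / 2 * (p0 w)\<^sup>2)"
  define K where "K = integral {0..1} s"
  have conts: "continuous_on {0..1} s" unfolding s_def using p_cont(1)[of 0] by (auto intro!: continuous_intros)
  have s_nonneg: "0 \<le> s w" for w by (simp add: s_def)
  \<comment> \<open>The weight vanishes at \<open>w = 0\<close>, so positivity of its integral rests
    on continuity and one nonzero value.\<close>
  have "s 1 \<noteq> 0" using p_bounds(1)[of 0 1] by (simp add: s_def)
  then have "K \<noteq> 0"
    using integral_eq_0_iff[OF conts] s_nonneg unfolding K_def by auto
  moreover have "0 \<le> K" unfolding K_def
    by (intro Henstock_Kurzweil_Integration.integral_nonneg integrable_continuous_interval conts) (use s_nonneg in auto)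
  ultimately have "K > 0" by simp
  have contc: "continuous_on {0..1} (\<lambda>w. w * (s w * cos (X0 w)))"
    using sliding_arc.X_cont[OF arcI[of 0]] by (auto intro!: continuous_intros conts)
  have main: "\<bar>integral {v..1} (\<lambda>w. w * (s w * cos (X0 w)))\<bar> \<le> K" if v: "v \<in> {0..1}" for v
  proof -
    have "norm (integral {v..1} (\<lambda>w. w * (s w * cos (X0 w)))) \<le> integral {v..1} s"
    proof (rule integral_norm_bound_integral)
      fix w assume "w \<in> {v..1}"
      then have "\<bar>w\<bar> \<le> 1" using v by auto
      moreover have "\<bar>s w * cos (X0 w)\<bar> \<le> s w"
        using s_nonneg[of w] abs_cos_le_one[of "X0 w"] by (simp add: abs_mult mult_left_le)
      ultimately show "norm (w * (s w * cos (X0 w))) \<le> s w"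
        using mult_mono[of "\<bar>w\<bar>" 1 "\<bar>s w * cos (X0 w)\<bar>" "s w"] by (simp add: abs_mult)
    qed (use v in \<open>auto intro!: integrable_continuous_interval continuous_on_subset[OF contc] continuous_on_subset[OF conts]\<close>)
    also have "\<dots> \<le> K"
      unfolding K_def using v s_nonneg
      by (intro integral_subset_le integrable_continuous_interval conts continuous_on_subset[OF conts]) auto
    finally show ?thesis by simp
  qed
  \<comment> \<open>Splits \<open>q\<close> into its source, the value at x = 0, and the feedback,
    which is linear in x.\<close>
  have q_eq: "q w x = s w * cos (X0 w) - (q w 0 - q w x)" for w x
    by (simp add: q_def s_def)
  have bound: "\<bar>u v\<bar> \<le> 2 * K" if v: "v \<in> {0..1}" for v
  proof -
    have contq: "continuous_on {0..1} (\<lambda>w. w * q w (u w))"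
      by (intro continuous_intros q_cont contu)
    let ?Y = "\<lambda>v. integral {v..1} (\<lambda>w. w * (s w * cos (X0 w)))"
    \<comment> \<open>\<open>?Y\<close> is the solution without feedback and is bounded by
      \<open>K\<close>. Writing u as (u - ?Y) + ?Y, the first summand is absorbed by the stability
      estimate; altogether |u| \<le> K + 3/8 K.\<close>
    have "\<bar>u v - ?Y v\<bar> \<le> 2 * (3 / 16 * K)"
    proof (rule backward_integral_close[OF contq contc u refl _ v])
      fix w :: real assume w: "w \<in> {0..1}"
      have "\<bar>q w (u w) - s w * cos (X0 w)\<bar> \<le> 3 / 16 * \<bar>u w\<bar>"
        using q_lipschitz[OF w, of "u w" 0] q_eq[of w "u w"] by (simp add: abs_minus_commute)
      also have "\<dots> \<le> \<bar>u w - ?Y w\<bar> / 2 + 3 / 16 * K"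
      proof -
        have "\<bar>u w\<bar> \<le> \<bar>u w - ?Y w\<bar> + \<bar>?Y w\<bar>" using abs_triangle_ineq[of "u w - ?Y w" "?Y w"] by simp
        then show ?thesis using main[OF w] abs_ge_zero[of "u w - ?Y w"] by argo
      qed
      finally show "\<bar>w * q w (u w) - w * (s w * cos (X0 w))\<bar> \<le> \<bar>u w - ?Y w\<bar> / 2 + 3 / 16 * K"
        unfolding right_diff_distrib[symmetric] by (rule abs_weighted_le[OF w])
    qed
    moreover have "\<bar>u v\<bar> \<le> \<bar>u v - ?Y v\<bar> + \<bar>?Y v\<bar>" using abs_triangle_ineq[of "u v - ?Y v" "?Y v"] by simp
    ultimately show ?thesis using main[OF v] \<open>K > 0\<close> by argo
  qed
  \<comment> \<open>The left side equals K/8; it is written as the integral of the pointwise lower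
    bound for \<open>q\<close>.\<close>
  have "K / 2 - 3 / 16 * (2 * K) = integral {0..1} (\<lambda>w. s w / 2 - 3 / 16 * (2 * K))"
    using conts by (subst Henstock_Kurzweil_Integration.integral_diff)
      (auto simp: K_def intro!: integrable_continuous_interval continuous_intros)
  also have "\<dots> \<le> integral {0..1} (\<lambda>w. q w (u w))"
  proof (rule integral_le)
    fix w :: real assume w: "w \<in> {0..1}"
    have "s w * (1 / 2) \<le> s w * cos (X0 w)" using cos_X0_ge[OF w] s_nonneg by (rule mult_left_mono)
    moreover have "\<bar>q w 0 - q w (u w)\<bar> \<le> 3 / 16 * (2 * K)"
      using q_lipschitz[OF w, of 0 "u w"] bound[OF w] by simp
    ultimately show "s w / 2 - 3 / 16 * (2 * K) \<le> q w (u w)" using q_eq[of w "u w"] by linarith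
  qed (auto intro!: integrable_continuous_interval continuous_intros conts q_cont contu)
  finally show ?thesis using \<open>K > 0\<close> by simp
qed

text \<open>The linearised equation is solved by the same Picard argument. Stability with \<epsilon>
  = 2 \<beta> brings \<open>U\<close> within 4 \<beta> of its solution, whence the error 3/16 times
  4 \<beta> plus 2 \<beta>, below 3 \<beta>.\<close>

lemma Q_limit:
  obtains Q0 where "continuous_on {0..1} Q0" "integral {0..1} Q0 > 0"
    "\<And>\<beta> w. 0 < \<beta> \<Longrightarrow> \<beta> \<le> 1 \<Longrightarrow> w \<in> {0..1} \<Longrightarrow> \<bar>Q \<beta> w - Q0 w\<bar> \<le> 3 * \<beta>"
proof -
  obtain u where u: "continuous_on {0..1} u" "\<And>v. v \<in> {0..1} \<Longrightarrow> u v = integral {v..1} (\<lambda>w. w * q w (u w))"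
  proof (rule backward_picard[of "\<lambda>w x. w * q w x"])
    have "continuous_on ({0..1} \<times> UNIV) (\<lambda>z. X0 (fst z))" "continuous_on ({0..1} \<times> UNIV) (\<lambda>z. p0 (fst z))"
      using sliding_arc.X_cont[OF arcI[of 0]] p_cont(1)[of 0]
      by (auto intro!: continuous_on_compose2[where f = fst] continuous_intros)
    then show "continuous_on ({0..1} \<times> UNIV) (\<lambda>(w, x). w * q w x)"
      unfolding case_prod_unfold q_def by (intro continuous_intros) auto
    fix w x y :: real assume w: "w \<in> {0..1}"
    show "\<bar>w * q w x - w * q w y\<bar> \<le> \<bar>x - y\<bar> / 2"
      unfolding right_diff_distrib[symmetric]
      by (rule abs_weighted_le[OF w], rule order_trans[OF q_lipschitz[OF w]]) simp
  qed blast
  show thesis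
  proof
    show "continuous_on {0..1} (\<lambda>w. q w (u w))" by (intro q_cont u)
    show "integral {0..1} (\<lambda>w. q w (u w)) > 0" using u by (rule q_positive)
    fix \<beta> w :: real assume \<beta>: "0 < \<beta>" "\<beta> \<le> 1" and w: "w \<in> {0..1}"
    have close: "\<bar>Q \<beta> w - q w (u w)\<bar> \<le> 3 / 16 * \<bar>U \<beta> w - u w\<bar> + 2 * \<beta>" if "w \<in> {0..1}" for w
      using Q_close_q[OF \<beta> that] q_lipschitz[OF that, of "U \<beta> w" "u w"] by linarith
    have "\<bar>U \<beta> w - u w\<bar> \<le> 2 * (2 * \<beta>)"
    proof (rule backward_integral_close[OF _ _ _ u(2) _ w])
      show "continuous_on {0..1} (\<lambda>w. w * Q \<beta> w)" "continuous_on {0..1} (\<lambda>w. w * q w (u w))"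
        using \<beta> u by (auto intro!: continuous_intros Q_cont q_cont)
      show "U \<beta> v = integral {v..1} (\<lambda>w. w * Q \<beta> w)" if "v \<in> {0..1}" for v
        using \<beta> that by (intro integral_Q) auto
      fix w :: real assume w: "w \<in> {0..1}"
      show "\<bar>w * Q \<beta> w - w * q w (u w)\<bar> \<le> \<bar>U \<beta> w - u w\<bar> / 2 + 2 * \<beta>"
        unfolding right_diff_distrib[symmetric]
        by (rule abs_weighted_le[OF w], rule order_trans[OF close[OF w]]) simp
    qed
    then show "\<bar>Q \<beta> w - q w (u w)\<bar> \<le> 3 * \<beta>" using close[OF w] \<beta> by argo
  qed
qed

section \<open>From slownesses to stopping times and to speeds at a fixed time\<close>

abbreviation "clockI \<beta> \<equiv> sliding_arc.clock \<gamma> 4 (implicit_force potential \<beta>) (XI \<beta>)"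
abbreviation "clockE \<beta> \<equiv> sliding_arc.clock \<gamma> 4 (explicit_force potential \<beta>) (XE \<beta>)"
abbreviation "speedI \<beta> \<equiv> sliding_arc.speed \<gamma> 4 (implicit_force potential \<beta>) (XI \<beta>)"
abbreviation "speedE \<beta> \<equiv> sliding_arc.speed \<gamma> 4 (explicit_force potential \<beta>) (XE \<beta>)"
abbreviation "clock0 \<equiv> clockI 0"
abbreviation "speed0 \<equiv> speedI 0"

lemma clock_eq:
  "\<beta> \<ge> 0 \<Longrightarrow> clockI \<beta> v = integral {v..1} (pI \<beta>)"
  "\<beta> \<ge> 0 \<Longrightarrow> clockE \<beta> v = integral {v..1} (pE \<beta>)"
  by (simp_all add: sliding_arc.clock_def[OF arcI] sliding_arc.clock_def[OF arcE])

lemma clocks_close: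
  assumes "\<beta> \<ge> 0" "v \<in> {0..1}"
  shows "\<bar>clockI \<beta> v - clock0 v\<bar> \<le> \<beta>" "\<bar>clockE \<beta> v - clock0 v\<bar> \<le> \<beta>"
  unfolding clock_eq[OF assms(1)] clock_eq(1)[OF order_refl]
  by (rule integral_close; use assms p_cont arcs_close in auto)+

text \<open>For small \<beta> both particles still move at time \<open>t\<close>, so each clock,
  read at the current speed, shows \<open>t\<close>. The reference clock read at that speed is then
  off by at most \<beta>, and continuity of the single function \<open>speed0\<close> gives the
  limit; the \<beta>-dependent inverses need not be controlled.\<close>

lemma speed_at_tendsto:
  assumes v: "v \<in> {0<..<1}" and t: "t = clock0 v"
  shows "(\<forall>\<^sub>F \<beta> in at_right 0. clockI \<beta> (speedI \<beta> t) = t \<and> clockE \<beta> (speedE \<beta> t) = t)"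
    and "((\<lambda>\<beta>. speedI \<beta> t) \<longlongrightarrow> v) (at_right 0)" "((\<lambda>\<beta>. speedE \<beta> t) \<longlongrightarrow> v) (at_right 0)"
proof -
  note arc0 = arcI[OF order_refl]
  have t_bounds: "0 < t" "t < clock0 0"
    using sliding_arc.clock_less[OF arc0, of v 1] sliding_arc.clock_less[OF arc0, of 0 v]
      sliding_arc.clock_1[OF arc0] v t by auto
  have "\<forall>\<^sub>F \<beta> in at_right 0. \<beta> < clock0 0 - t"
    using t_bounds by (auto simp: eventually_at_right_field intro!: exI[of _ "clock0 0 - t"])
  with eventually_small have ev: "\<forall>\<^sub>F \<beta> in at_right 0. 0 < \<beta> \<and> \<beta> < clock0 0 - t"
    by eventually_elim auto
  show hit: "\<forall>\<^sub>F \<beta> in at_right 0. clockI \<beta> (speedI \<beta> t) = t \<and> clockE \<beta> (speedE \<beta> t) = t"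
    using ev
  proof eventually_elim
    case (elim \<beta>)
    then have "t < clockI \<beta> 0" "t < clockE \<beta> 0"
      using clocks_close[of \<beta> 0] by auto
    then show ?case
      using elim t_bounds sliding_arc.clock_speed[OF arcI, of \<beta> t] sliding_arc.clock_speed[OF arcE, of \<beta> t] by simp
  qed
  have inv: "speed0 (clock0 w) = w" if "w \<in> {0..1}" for w
    using sliding_arc.speed_clock[OF arc0 that] by blast
  have cont: "isCont speed0 t"
    using continuous_on_interior[OF sliding_arc.speed_cont[OF arc0], of t] t_bounds by simp
  have in01: "speedI \<beta> t \<in> {0..1}" "speedE \<beta> t \<in> {0..1}" if "0 < \<beta>" for \<beta>
    using sliding_arc.speed_in[OF arcI, of \<beta> t] sliding_arc.speed_in[OF arcE, of \<beta> t] t_bounds that by auto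
  \<comment> \<open>Stated for an arbitrary family \<open>V\<close> of speeds, to serve both
    schemes.\<close>
  have lim: "((\<lambda>\<beta>. V \<beta>) \<longlongrightarrow> v) (at_right 0)"
    if V: "\<forall>\<^sub>F \<beta> in at_right 0. V \<beta> \<in> {0..1} \<and> \<bar>clock0 (V \<beta>) - t\<bar> \<le> 1 * \<beta>" for V
  proof (rule Lim_transform_eventually)
    have "((\<lambda>\<beta>. clock0 (V \<beta>)) \<longlongrightarrow> t) (at_right 0)"
      by (rule tendsto_at_right_rate) (use V in eventually_elim, blast)
    then have "((\<lambda>\<beta>. speed0 (clock0 (V \<beta>))) \<longlongrightarrow> speed0 t) (at_right 0)"
      by (rule isCont_tendsto_compose[OF cont])
    then show "((\<lambda>\<beta>. speed0 (clock0 (V \<beta>))) \<longlongrightarrow> v) (at_right 0)"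
      using inv[of v] v t by simp
    show "\<forall>\<^sub>F \<beta> in at_right 0. speed0 (clock0 (V \<beta>)) = V \<beta>"
      using V by eventually_elim (use inv in blast)
  qed
  show "((\<lambda>\<beta>. speedI \<beta> t) \<longlongrightarrow> v) (at_right 0)"
  proof (rule lim)
    show "\<forall>\<^sub>F \<beta> in at_right 0. speedI \<beta> t \<in> {0..1} \<and> \<bar>clock0 (speedI \<beta> t) - t\<bar> \<le> 1 * \<beta>"
      using ev hit
    proof eventually_elim
      case (elim \<beta>)
      then show ?case using in01[of \<beta>] clocks_close(1)[of \<beta> "speedI \<beta> t"] by (auto simp: abs_minus_commute)
    qed
  qed
  show "((\<lambda>\<beta>. speedE \<beta> t) \<longlongrightarrow> v) (at_right 0)"
  proof (rule lim)
    show "\<forall>\<^sub>F \<beta> in at_right 0. speedE \<beta> t \<in> {0..1} \<and> \<bar>clock0 (speedE \<beta> t) - t\<bar> \<le> 1 * \<beta>"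
      using ev hit
    proof eventually_elim
      case (elim \<beta>)
      then show ?case using in01[of \<beta>] clocks_close(2)[of \<beta> "speedE \<beta> t"] by (auto simp: abs_minus_commute)
    qed
  qed
qed

text \<open>\<open>D v\<close> is the limit of the rescaled delay with which the implicit particle
  reaches speed \<open>v\<close>. Positivity is obtained for the whole speed range,
  \<open>v = 0\<close>, where the delay is that of the stopping times.\<close>

lemma clock_limit:
  obtains D where "continuous_on {0..1} D" "D 0 > 0"
    "\<And>\<beta> v. 0 < \<beta> \<Longrightarrow> \<beta> \<le> 1 \<Longrightarrow> v \<in> {0..1} \<Longrightarrow> \<bar>(clockI \<beta> v - clockE \<beta> v) / \<beta>\<^sup>2 - D v\<bar> \<le> 3 * \<beta>"
proof -
  obtain Q0 where Q0: "continuous_on {0..1} Q0" "integral {0..1} Q0 > 0"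
    "\<And>\<beta> w. 0 < \<beta> \<Longrightarrow> \<beta> \<le> 1 \<Longrightarrow> w \<in> {0..1} \<Longrightarrow> \<bar>Q \<beta> w - Q0 w\<bar> \<le> 3 * \<beta>"
    using Q_limit by blast
  show thesis
  proof
    show "continuous_on {0..1} (\<lambda>v. integral {v..1} Q0)" by (rule continuous_on_backward_integral[OF Q0(1)])
    fix \<beta> v :: real assume \<beta>: "0 < \<beta>" "\<beta> \<le> 1" and v: "v \<in> {0..1}"
    have "\<bar>integral {v..1} (Q \<beta>) - integral {v..1} Q0\<bar> \<le> 3 * \<beta>"
      by (rule integral_close) (use \<beta> v Q0 Q_cont in auto)
    then show "\<bar>(clockI \<beta> v - clockE \<beta> v) / \<beta>\<^sup>2 - integral {v..1} Q0\<bar> \<le> 3 * \<beta>"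
      using \<beta> v by (simp add: integral_Q clock_eq)
  qed fact
qed

lemma stopping_gap:
  obtains c where "c > 0" "((\<lambda>\<beta>. (clockI \<beta> 0 - clockE \<beta> 0) / \<beta>\<^sup>2) \<longlongrightarrow> c) (at_right 0)"
proof -
  obtain D where D: "D 0 > 0"
    "\<And>\<beta> v. 0 < \<beta> \<Longrightarrow> \<beta> \<le> 1 \<Longrightarrow> v \<in> {0..1} \<Longrightarrow> \<bar>(clockI \<beta> v - clockE \<beta> v) / \<beta>\<^sup>2 - D v\<bar> \<le> 3 * \<beta>"
    using clock_limit by metis
  have "((\<lambda>\<beta>. (clockI \<beta> 0 - clockE \<beta> 0) / \<beta>\<^sup>2) \<longlongrightarrow> D 0) (at_right 0)"
    by (rule tendsto_at_right_rate[where C = 3]) (use eventually_small in eventually_elim, use D(2) in auto)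
  with D(1) show thesis by (rule that)
qed

text \<open>Positivity of \<open>D\<close> at 0 persists by continuity at a small speed
  \<open>v > 0\<close>, so the comparison time is taken shortly before the reference particle stops.
  A delay in reaching a given speed becomes a speed gap at a given time after division by the
  slowness, hence the constant \<open>D v / p0 v\<close>.\<close>

lemma speed_gap:
  obtains t c where "0 < t" "t < clock0 0" "c > 0"
    "((\<lambda>\<beta>. (speedI \<beta> t - speedE \<beta> t) / \<beta>\<^sup>2) \<longlongrightarrow> c) (at_right 0)"
proof -
  note arc0 = arcI[OF order_refl]
  obtain D where D: "continuous_on {0..1} D" "D 0 > 0"
    "\<And>\<beta> v. 0 < \<beta> \<Longrightarrow> \<beta> \<le> 1 \<Longrightarrow> v \<in> {0..1} \<Longrightarrow> \<bar>(clockI \<beta> v - clockE \<beta> v) / \<beta>\<^sup>2 - D v\<bar> \<le> 3 * \<beta>"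
    using clock_limit by metis
  obtain d where d: "d > 0" "\<And>v. v \<in> {0..1} \<Longrightarrow> dist v 0 < d \<Longrightarrow> dist (D v) (D 0) < D 0"
    using D(1,2) unfolding continuous_on_iff by (metis atLeastAtMost_iff order_refl zero_le_one)
  \<comment> \<open>Half of \<open>d\<close> stays strictly within the continuity radius, and the
    cap 1/2 keeps \<open>v\<close> strictly between 0 and 1.\<close>
  define v where "v = min (d / 2) (1 / 2)"
  have v: "v \<in> {0<..<1}" and v': "v \<in> {0..1}" and "dist v 0 < d" using d(1) by (auto simp: v_def min_def)
  then have "D v > 0" using d(2)[of v] by (auto simp: dist_real_def)
  define t where "t = clock0 v"
  have t: "0 < t" "t < clock0 0"
    using sliding_arc.clock_less[OF arc0, of v 1] sliding_arc.clock_less[OF arc0, of 0 v]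
      sliding_arc.clock_1[OF arc0] v by (auto simp: t_def)
  note hit = speed_at_tendsto(1)[OF v t_def] and limI = speed_at_tendsto(2)[OF v t_def]
    and limE = speed_at_tendsto(3)[OF v t_def]
  have in01: "speedI \<beta> t \<in> {0..1}" "speedE \<beta> t \<in> {0..1}" if "0 < \<beta>" for \<beta>
    using sliding_arc.speed_in[OF arcI, of \<beta> t] sliding_arc.speed_in[OF arcE, of \<beta> t] t that by auto
  \<comment> \<open>Both clocks show \<open>t\<close> at their own speeds, so the delay at the speed
    \<open>speedE \<beta> t\<close> is an increment of the implicit clock alone, to which the mean
    value theorem applies.\<close>
  have "\<exists>\<xi>. min (speedE \<beta> t) (speedI \<beta> t) \<le> \<xi> \<and> \<xi> \<le> max (speedE \<beta> t) (speedI \<beta> t) \<and>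
      clockI \<beta> (speedE \<beta> t) - clockI \<beta> (speedI \<beta> t) = pI \<beta> \<xi> * (speedI \<beta> t - speedE \<beta> t)" if "0 < \<beta>" for \<beta>
    using sliding_arc.clock_mvt[OF arcI in01(2)[OF that] in01(1)[OF that], of \<beta>] that by (metis less_imp_le)
  then obtain \<xi> where \<xi>: "\<And>\<beta>. 0 < \<beta> \<Longrightarrow> min (speedE \<beta> t) (speedI \<beta> t) \<le> \<xi> \<beta> \<and> \<xi> \<beta> \<le> max (speedE \<beta> t) (speedI \<beta> t) \<and>
      clockI \<beta> (speedE \<beta> t) - clockI \<beta> (speedI \<beta> t) = pI \<beta> (\<xi> \<beta>) * (speedI \<beta> t - speedE \<beta> t)"
    by metis
  have \<xi>01: "\<xi> \<beta> \<in> {0..1}" if "0 < \<beta>" for \<beta>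
    using \<xi>[OF that] in01[OF that] by (auto simp: min_def max_def split: if_splits)
  have lim\<xi>: "(\<xi> \<longlongrightarrow> v) (at_right 0)"
  proof (rule tendsto_sandwich)
    show "((\<lambda>\<beta>. min (speedE \<beta> t) (speedI \<beta> t)) \<longlongrightarrow> v) (at_right 0)"
      using tendsto_min[OF limE limI] by simp
    show "((\<lambda>\<beta>. max (speedE \<beta> t) (speedI \<beta> t)) \<longlongrightarrow> v) (at_right 0)"
      using tendsto_max[OF limE limI] by simp
    show "\<forall>\<^sub>F \<beta> in at_right 0. min (speedE \<beta> t) (speedI \<beta> t) \<le> \<xi> \<beta>"
      "\<forall>\<^sub>F \<beta> in at_right 0. \<xi> \<beta> \<le> max (speedE \<beta> t) (speedI \<beta> t)"
      using eventually_small by (eventually_elim, use \<xi> in blast)+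
  qed
  have interior: "isCont g v" if "continuous_on {0..1} g" for g :: "real \<Rightarrow> real"
    using continuous_on_interior[OF that, of v] v by simp
  have "((\<lambda>\<beta>. pI \<beta> (\<xi> \<beta>) - p0 (\<xi> \<beta>)) \<longlongrightarrow> 0) (at_right 0)"
    by (rule tendsto_at_right_rate[where C = 1])
      (use eventually_small in eventually_elim, use arcs_close(3) \<xi>01 in auto)
  from tendsto_add[OF this isCont_tendsto_compose[OF interior[OF p_cont(1)[OF order_refl]] lim\<xi>]]
  have limp: "((\<lambda>\<beta>. pI \<beta> (\<xi> \<beta>)) \<longlongrightarrow> p0 v) (at_right 0)" by simp
  have "((\<lambda>\<beta>. (clockI \<beta> (speedE \<beta> t) - clockE \<beta> (speedE \<beta> t)) / \<beta>\<^sup>2 - D (speedE \<beta> t)) \<longlongrightarrow> 0) (at_right 0)"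
    by (rule tendsto_at_right_rate[where C = 3])
      (use eventually_small in eventually_elim, use D(3) in01 in auto)
  from tendsto_add[OF this isCont_tendsto_compose[OF interior[OF D(1)] limE]]
  have limD: "((\<lambda>\<beta>. (clockI \<beta> (speedE \<beta> t) - clockE \<beta> (speedE \<beta> t)) / \<beta>\<^sup>2) \<longlongrightarrow> D v) (at_right 0)" by simp
  have "p0 v > 0" using p_bounds(1)[OF order_refl v'] .
  show thesis
  proof (rule that[of t "D v / p0 v"])
    show "0 < D v / p0 v" using \<open>D v > 0\<close> \<open>p0 v > 0\<close> by simp
    show "((\<lambda>\<beta>. (speedI \<beta> t - speedE \<beta> t) / \<beta>\<^sup>2) \<longlongrightarrow> D v / p0 v) (at_right 0)"
    proof (rule Lim_transform_eventually)
      show "((\<lambda>\<beta>. (clockI \<beta> (speedE \<beta> t) - clockE \<beta> (speedE \<beta> t)) / \<beta>\<^sup>2 / pI \<beta> (\<xi> \<beta>)) \<longlongrightarrow> D v / p0 v) (at_right 0)"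
        using limD limp \<open>p0 v > 0\<close> by (intro tendsto_divide) auto
      show "\<forall>\<^sub>F \<beta> in at_right 0. (clockI \<beta> (speedE \<beta> t) - clockE \<beta> (speedE \<beta> t)) / \<beta>\<^sup>2 / pI \<beta> (\<xi> \<beta>)
          = (speedI \<beta> t - speedE \<beta> t) / \<beta>\<^sup>2"
        using eventually_small hit
      proof eventually_elim
        case (elim \<beta>)
        then have "clockI \<beta> (speedE \<beta> t) - clockE \<beta> (speedE \<beta> t) = pI \<beta> (\<xi> \<beta>) * (speedI \<beta> t - speedE \<beta> t)"
          using \<xi>[of \<beta>] by simp
        moreover have "pI \<beta> (\<xi> \<beta>) \<noteq> 0" using p_bounds(1)[of \<beta> "\<xi> \<beta>"] \<xi>01[of \<beta>] elim by auto
        ultimately show ?case by simp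
      qed
    qed
  qed (rule t)+
qed

end

theorem proposition3p9:
  fixes \<gamma> :: real
  assumes "\<gamma> > 0"
  shows "\<exists>(f :: real \<Rightarrow> real) (r :: real) (\<phi> :: real \<Rightarrow> real) (x0 :: real) (v0 :: real).
    smooth f \<and> strongly_convex f \<and>
    globally_lipschitz (deriv f) \<and> globally_lipschitz (deriv (deriv f)) \<and>
    r > 0 \<and> \<phi> = (\<lambda>v. r * \<bar>v\<bar>) \<and>
    (\<exists>(xI :: real \<Rightarrow> real \<Rightarrow> real) vI xE vE x v.
      (\<forall>\<beta>\<ge>0. the_global_strong_solution \<gamma> \<phi> (implicit_force f \<beta>) x0 v0 (xI \<beta>) (vI \<beta>)) \<and>
      (\<forall>\<beta>\<ge>0. the_global_strong_solution \<gamma> \<phi> (explicit_force f \<beta>) x0 v0 (xE \<beta>) (vE \<beta>)) \<and>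
      the_global_strong_solution \<gamma> \<phi> (implicit_force f 0) x0 v0 x v \<and>
      the_global_strong_solution \<gamma> \<phi> (explicit_force f 0) x0 v0 x v \<and>
      (\<exists>T0 :: real. stopping_time v = ereal T0 \<and> T0 > 0 \<and>
        (\<exists>\<delta>>0. (\<lambda>s. - deriv f (x T0) + s) ` {-\<delta>..\<delta>} \<subseteq> subdifferential \<phi> 0) \<and>
        subdifferential \<phi> 0 = {-r..r} \<and>
        (\<exists>t c. 0 < t \<and> t < T0 \<and> c > 0 \<and>
          ((\<lambda>\<beta>. (vI \<beta> t - vE \<beta> t) / \<beta>\<^sup>2) \<longlongrightarrow> c) (at_right 0)) \<and>
        (\<forall>\<^sub>F \<beta> in at_right 0.
          \<bar>stopping_time (vI \<beta>)\<bar> \<noteq> \<infinity> \<and> \<bar>stopping_time (vE \<beta>)\<bar> \<noteq> \<infinity>) \<and>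
        (\<exists>c_stop>0.
          ((\<lambda>\<beta>. (real_of_ereal (stopping_time (vI \<beta>)) - real_of_ereal (stopping_time (vE \<beta>))) / \<beta>\<^sup>2)
            \<longlongrightarrow> c_stop) (at_right 0))))"
proof -
  let ?I = "implicit_force potential" and ?E = "explicit_force potential" and ?\<phi> = "\<lambda>v::real. 4 * \<bar>v\<bar>"
  obtain XI where XI: "\<And>\<beta>. \<beta> \<ge> 0 \<Longrightarrow> sliding_arc \<gamma> 4 (?I \<beta>) (XI \<beta>)"
    using sliding_arc_implicit[OF assms] by metis
  obtain XE where XE: "\<And>\<beta>. \<beta> \<ge> 0 \<Longrightarrow> sliding_arc \<gamma> 4 (?E \<beta>) (XE \<beta>)"
    using sliding_arc_explicit[OF assms] by metis
  interpret two_schemes \<gamma> XI XE by (rule two_schemes.intro) (fact XI XE)+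
  define xI where "xI = (\<lambda>\<beta>. sliding_arc.position \<gamma> 4 (?I \<beta>) (XI \<beta>))"
  define xE where "xE = (\<lambda>\<beta>. sliding_arc.position \<gamma> 4 (?E \<beta>) (XE \<beta>))"
  have solI: "the_global_strong_solution \<gamma> ?\<phi> (?I \<beta>) 0 1 (xI \<beta>) (speedI \<beta>)" if "\<beta> \<ge> 0" for \<beta>
    unfolding xI_def using assms that
    by (intro the_global_strong_solutionI locally_lipschitz_implicit sliding_arc.global_strong_solution XI) auto
  have solE: "the_global_strong_solution \<gamma> ?\<phi> (?E \<beta>) 0 1 (xE \<beta>) (speedE \<beta>)" if "\<beta> \<ge> 0" for \<beta>
    unfolding xE_def using assms that
    by (intro the_global_strong_solutionI locally_lipschitz_explicit sliding_arc.global_strong_solution XE) auto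
  \<comment> \<open>At \<beta> = 0 the forces coincide, so the implicit solution with \<beta> = 0 is
    the required common solution.\<close>
  have "?E 0 = ?I 0" by (simp add: explicit_force_potential implicit_force_potential)
  with solI[of 0] have sol0: "the_global_strong_solution \<gamma> ?\<phi> (?E 0) 0 1 (xI 0) (speedI 0)" by simp
  have stopI: "stopping_time (speedI \<beta>) = ereal (clockI \<beta> 0)" if "\<beta> \<ge> 0" for \<beta>
    using sliding_arc.stopping_time_speed[OF XI[OF that]] .
  have stopE: "stopping_time (speedE \<beta>) = ereal (clockE \<beta> 0)" if "\<beta> \<ge> 0" for \<beta>
    using sliding_arc.stopping_time_speed[OF XE[OF that]] .
  obtain t c where tc: "0 < t" "t < clock0 0" "c > 0"
    "((\<lambda>\<beta>. (speedI \<beta> t - speedE \<beta> t) / \<beta>\<^sup>2) \<longlongrightarrow> c) (at_right 0)" by (rule speed_gap)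
  obtain c_stop where c_stop: "c_stop > 0"
    "((\<lambda>\<beta>. (clockI \<beta> 0 - clockE \<beta> 0) / \<beta>\<^sup>2) \<longlongrightarrow> c_stop) (at_right 0)" by (rule stopping_gap)
  have x_stop: "xI 0 (clock0 0) = XI 0 0"
    using sliding_arc.speed_after[OF XI order_refl, of 0] by (simp add: xI_def sliding_arc.position_def[OF XI])
  have "0 \<le> slope (XI 0 0)" "slope (XI 0 0) \<le> 3"
    using sliding_arc.X_nonneg[OF XI, of 0 0] sliding_arc.X_le[OF XI, of 0 0]
    by (intro slope_nonneg slope_stick; simp)+
  \<comment> \<open>The margin \<delta> = 1 is the friction coefficient 4 minus the bound 3 for f'
    at the resting point; nonnegativity of f' settles the other side.\<close>
  then have margin: "(\<lambda>s. - deriv potential (xI 0 (clock0 0)) + s) ` {-1..1} \<subseteq> subdifferential ?\<phi> 0"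
    by (auto simp: x_stop deriv_potential subdifferential_friction_zero)
  have finite: "\<forall>\<^sub>F \<beta> in at_right 0. \<bar>stopping_time (speedI \<beta>)\<bar> \<noteq> \<infinity> \<and> \<bar>stopping_time (speedE \<beta>)\<bar> \<noteq> \<infinity>"
    using eventually_small by eventually_elim (simp add: stopI stopE)
  have gap: "((\<lambda>\<beta>. (real_of_ereal (stopping_time (speedI \<beta>)) - real_of_ereal (stopping_time (speedE \<beta>))) / \<beta>\<^sup>2)
      \<longlongrightarrow> c_stop) (at_right 0)"
    by (rule Lim_transform_eventually[OF c_stop(2)])
      (use eventually_small in eventually_elim, simp add: stopI stopE)
  show ?thesis
  proof (rule exI[of _ potential], rule exI[of _ 4], rule exI[of _ ?\<phi>], rule exI[of _ 0], rule exI[of _ 1], intro conjI;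
      (rule exI[of _ xI], rule exI[of _ speedI], rule exI[of _ xE], rule exI[of _ speedE],
        rule exI[of _ "xI 0"], rule exI[of _ "speedI 0"], intro conjI; (rule exI[of _ "clock0 0"], intro conjI)?)?)
    show "smooth potential" by (rule smooth_potential)
    show "strongly_convex potential" by (rule strongly_convex_potential)
    show "globally_lipschitz (deriv potential)" unfolding deriv_potential by (rule lipschitz_slope)
    show "globally_lipschitz (deriv (deriv potential))"
      unfolding deriv_potential deriv_slope by (rule lipschitz_deriv_slope)
    show "subdifferential ?\<phi> 0 = {-4..4}" by (rule subdifferential_friction_zero) simp
    show "\<exists>\<delta>>0. (\<lambda>s. - deriv potential (xI 0 (clock0 0)) + s) ` {-\<delta>..\<delta>} \<subseteq> subdifferential ?\<phi> 0"
      using margin by (intro exI[of _ 1]) simp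
    show "clock0 0 > 0" by (rule sliding_arc.clock_0_pos[OF XI]) simp
    show "\<exists>t c. 0 < t \<and> t < clock0 0 \<and> c > 0 \<and>
        ((\<lambda>\<beta>. (speedI \<beta> t - speedE \<beta> t) / \<beta>\<^sup>2) \<longlongrightarrow> c) (at_right 0)"
      using tc by blast
  qed (use solI solE sol0 stopI finite gap c_stop(1) in auto)
qed

end
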